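(* Let $\mathbb{E}$ be a regular category and suppose that any chain of reflexive relations in $\mathbb{E}$ admits a supremum (among the reflexive relations on the same object) which is stable under composition of reflexive relations. Then the inclusions $PrO\,\mathbb{E}\hookrightarrow Ref\,\mathbb{E}$ and $Equ\,\mathbb{E}\hookrightarrow Ref\,\mathbb{E}$ have left adjoints.
   Context: A relation on $X$ is (a class up to isomorphism of) a subobject $R\rightarrowtail X\times X$, ordered by inclusion. In a regular category relations compose: $SR=S\circ R$ is the usual composite relation ($x(SR)z$ iff there is $y$ with $xRy$ and $ySz$), defined by a pullback followed by the regular epi–mono factorization. $R$ is reflexive if $\Delta_X\subset R$, symmetric if $R^{op}\subset R$, transitive if $R\circ R\subset R$; a preorder is a reflexive transitive relation, an equivalence relation is a symmetric preorder. For $f:X\to Y$ and a relation $S$ on $Y$, $f^{-1}(S)$ is the pullback of $S\rightarrowtail Y\times Y$ along $f\times f$. $Ref\,\mathbb{E}$ is the category whose objects are pairs (object $X$, reflexive relation $R$ on $X$) and in which a morphism from $R$ (on $X$) to $S$ (on $Y$) is a map $f:X\to Y$ such that $R\subset f^{-1}(S)$; $PrO\,\mathbb{E}$ and $Equ\,\mathbb{E}$ are its full subcategories of preorders and of equivalence relations. A chain of reflexive relations on $X$ is an increasing sequence $(R_i)_{i\in\mathbb{N}}$ of reflexive relations on $X$; $\Sigma_{i\in\mathbb{N}}R_i$ denotes its supremum in the ordered set of reflexive relations on $X$. These suprema are stable under composition of reflexive relations when $\Sigma_{i\in\mathbb{N}}(R_iT)=(\Sigma_{i\in\mathbb{N}}R_i)T$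 for every such chain and every reflexive relation $T$ on $X$. *)

theory Defs
  imports Main
begin

section \<open>Categories, functors, adjunctions\<close>

record ('o, 'm) cat =
  Ob :: "'o set"
  Ar :: "'m set"
  Dom :: "'m \<Rightarrow> 'o"
  Cod :: "'m \<Rightarrow> 'o"
  Idn :: "'o \<Rightarrow> 'm"
  Comp :: "'m \<Rightarrow> 'm \<Rightarrow> 'm" (infixr "\<cdot>\<index>" 75)

definition hom :: "('o, 'm) cat \<Rightarrow> 'o \<Rightarrow> 'o \<Rightarrow> 'm set" where
  "hom C a b = {f \<in> Ar C. Dom C f = a \<and> Cod C f = b}"

locale category =
  fixes C :: "('o, 'm) cat" (structure)
  assumes dom_ob: "f \<in> Ar C \<Longrightarrow> Dom C f \<in> Ob C"
    and cod_ob: "f \<in> Ar C \<Longrightarrow> Cod C f \<in> Ob C"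
    and idn_hom: "a \<in> Ob C \<Longrightarrow> Idn C a \<in> hom C a a"
    and comp_hom: "f \<in> hom C a b \<Longrightarrow> g \<in> hom C b c \<Longrightarrow> g \<cdot> f \<in> hom C a c"
    and comp_idn_right: "f \<in> hom C a b \<Longrightarrow> f \<cdot> Idn C a = f"
    and comp_idn_left: "f \<in> hom C a b \<Longrightarrow> Idn C b \<cdot> f = f"
    and comp_assoc: "f \<in> hom C a b \<Longrightarrow> g \<in> hom C b c \<Longrightarrow> h \<in> hom C c d
      \<Longrightarrow> (h \<cdot> g) \<cdot> f = h \<cdot> (g \<cdot> f)"

text \<open>The full subcategory on the objects satisfying \<open>P\<close>.\<close>

definition full_subcat :: "('o, 'm) cat \<Rightarrow> ('o \<Rightarrow> bool) \<Rightarrow> ('o, 'm) cat" where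
  "full_subcat C P = C\<lparr>Ob := {a \<in> Ob C. P a},
                       Ar := {f \<in> Ar C. P (Dom C f) \<and> P (Cod C f)}\<rparr>"

definition is_functor ::
  "('o1, 'm1) cat \<Rightarrow> ('o2, 'm2) cat \<Rightarrow> ('o1 \<Rightarrow> 'o2) \<Rightarrow> ('m1 \<Rightarrow> 'm2) \<Rightarrow> bool" where
  "is_functor A B Fo Fa \<longleftrightarrow> category A \<and> category B \<and>
     (\<forall>a\<in>Ob A. Fo a \<in> Ob B) \<and>
     (\<forall>f\<in>Ar A. Fa f \<in> hom B (Fo (Dom A f)) (Fo (Cod A f))) \<and>
     (\<forall>a\<in>Ob A. Fa (Idn A a) = Idn B (Fo a)) \<and>
     (\<forall>f\<in>Ar A. \<forall>g\<in>Ar A. Dom A g = Cod A f \<longrightarrow> Fa (g \<cdot>\<^bsub>A\<^esub> f) = Fa g \<cdot>\<^bsub>B\<^esub> Fa f)"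

text \<open>\<open>L : D \<rightarrow> A\<close> is left adjoint to \<open>G : A \<rightarrow> D\<close> via bijections
  \<open>\<phi> x y : A(L x, y) \<rightarrow> D(x, G y)\<close> natural in \<open>x\<close> and \<open>y\<close>.\<close>

definition adjunction ::
  "('o1, 'm1) cat \<Rightarrow> ('o2, 'm2) cat \<Rightarrow> ('o2 \<Rightarrow> 'o1) \<Rightarrow> ('m2 \<Rightarrow> 'm1) \<Rightarrow>
   ('o1 \<Rightarrow> 'o2) \<Rightarrow> ('m1 \<Rightarrow> 'm2) \<Rightarrow> ('o2 \<Rightarrow> 'o1 \<Rightarrow> 'm1 \<Rightarrow> 'm2) \<Rightarrow> bool" where
  "adjunction A D Lo La Go Ga \<phi> \<longleftrightarrow>
     is_functor D A Lo La \<and> is_functor A D Go Ga \<and>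
     (\<forall>x\<in>Ob D. \<forall>y\<in>Ob A. bij_betw (\<phi> x y) (hom A (Lo x) y) (hom D x (Go y))) \<and>
     (\<forall>h\<in>Ar D. \<forall>k\<in>Ar A. \<forall>g\<in>hom A (Lo (Cod D h)) (Dom A k).
        \<phi> (Dom D h) (Cod A k) (k \<cdot>\<^bsub>A\<^esub> g \<cdot>\<^bsub>A\<^esub> La h)
          = Ga k \<cdot>\<^bsub>D\<^esub> \<phi> (Cod D h) (Dom A k) g \<cdot>\<^bsub>D\<^esub> h)"

definition has_left_adjoint ::
  "('o1, 'm1) cat \<Rightarrow> ('o2, 'm2) cat \<Rightarrow> ('o1 \<Rightarrow> 'o2) \<Rightarrow> ('m1 \<Rightarrow> 'm2) \<Rightarrow> bool" where
  "has_left_adjoint A D Go Ga \<longleftrightarrow> (\<exists>Lo La \<phi>. adjunction A D Lo La Go Ga \<phi>)"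

section \<open>Regular categories\<close>

definition monic :: "('o, 'm) cat \<Rightarrow> 'm \<Rightarrow> bool" where
  "monic C m \<longleftrightarrow> m \<in> Ar C \<and>
     (\<forall>a. \<forall>u\<in>hom C a (Dom C m). \<forall>v\<in>hom C a (Dom C m). m \<cdot>\<^bsub>C\<^esub> u = m \<cdot>\<^bsub>C\<^esub> v \<longrightarrow> u = v)"

definition is_iso :: "('o, 'm) cat \<Rightarrow> 'm \<Rightarrow> bool" where
  "is_iso C i \<longleftrightarrow> i \<in> Ar C \<and> (\<exists>j\<in>hom C (Cod C i) (Dom C i).
     j \<cdot>\<^bsub>C\<^esub> i = Idn C (Dom C i) \<and> i \<cdot>\<^bsub>C\<^esub> j = Idn C (Cod C i))"

definition is_terminal :: "('o, 'm) cat \<Rightarrow> 'o \<Rightarrow> bool" where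
  "is_terminal C t \<longleftrightarrow> t \<in> Ob C \<and> (\<forall>a\<in>Ob C. \<exists>!f. f \<in> hom C a t)"

definition is_product :: "('o, 'm) cat \<Rightarrow> 'o \<Rightarrow> 'o \<Rightarrow> 'm \<Rightarrow> 'm \<Rightarrow> bool" where
  "is_product C a b p q \<longleftrightarrow>
     p \<in> hom C (Dom C p) a \<and> q \<in> hom C (Dom C p) b \<and>
     (\<forall>x. \<forall>u\<in>hom C x a. \<forall>v\<in>hom C x b.
        \<exists>!w. w \<in> hom C x (Dom C p) \<and> p \<cdot>\<^bsub>C\<^esub> w = u \<and> q \<cdot>\<^bsub>C\<^esub> w = v)"

text \<open>\<open>p\<close> and \<open>q\<close> are the projections of a pullback of \<open>f\<close> and \<open>g\<close>; thus \<open>p\<close> is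
  the pullback of \<open>g\<close> along \<open>f\<close>.\<close>

definition is_pullback :: "('o, 'm) cat \<Rightarrow> 'm \<Rightarrow> 'm \<Rightarrow> 'm \<Rightarrow> 'm \<Rightarrow> bool" where
  "is_pullback C f g p q \<longleftrightarrow>
     f \<in> Ar C \<and> g \<in> Ar C \<and> Cod C f = Cod C g \<and>
     p \<in> hom C (Dom C p) (Dom C f) \<and> q \<in> hom C (Dom C p) (Dom C g) \<and>
     f \<cdot>\<^bsub>C\<^esub> p = g \<cdot>\<^bsub>C\<^esub> q \<and>
     (\<forall>x. \<forall>u\<in>hom C x (Dom C f). \<forall>v\<in>hom C x (Dom C g). f \<cdot>\<^bsub>C\<^esub> u = g \<cdot>\<^bsub>C\<^esub> v \<longrightarrow>
        (\<exists>!w. w \<in> hom C x (Dom C p) \<and> p \<cdot>\<^bsub>C\<^esub> w = u \<and> q \<cdot>\<^bsub>C\<^esub> w = v))"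

definition is_coequalizer :: "('o, 'm) cat \<Rightarrow> 'm \<Rightarrow> 'm \<Rightarrow> 'm \<Rightarrow> bool" where
  "is_coequalizer C u v e \<longleftrightarrow>
     u \<in> Ar C \<and> v \<in> hom C (Dom C u) (Cod C u) \<and> e \<in> hom C (Cod C u) (Cod C e) \<and>
     e \<cdot>\<^bsub>C\<^esub> u = e \<cdot>\<^bsub>C\<^esub> v \<and>
     (\<forall>x. \<forall>h\<in>hom C (Cod C u) x. h \<cdot>\<^bsub>C\<^esub> u = h \<cdot>\<^bsub>C\<^esub> v \<longrightarrow>
        (\<exists>!w. w \<in> hom C (Cod C e) x \<and> w \<cdot>\<^bsub>C\<^esub> e = h))"

definition regular_epi :: "('o, 'm) cat \<Rightarrow> 'm \<Rightarrow> bool" where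
  "regular_epi C e \<longleftrightarrow> (\<exists>u v. is_coequalizer C u v e)"

text \<open>Finite completeness is given by a terminal object and pullbacks.\<close>

locale regular_category = category +
  assumes ex_terminal: "\<exists>t. is_terminal C t"
    and ex_pullback: "f \<in> Ar C \<Longrightarrow> g \<in> Ar C \<Longrightarrow> Cod C f = Cod C g \<Longrightarrow> \<exists>p q. is_pullback C f g p q"
    and kernel_pair_coequalizer: "is_pullback C f f p q \<Longrightarrow> \<exists>e. is_coequalizer C p q e"
    and regular_epi_stable: "is_pullback C f g p q \<Longrightarrow> regular_epi C g \<Longrightarrow> regular_epi C p"

section \<open>Relations\<close>

text \<open>A chosen product \<open>X \<times> X\<close>.\<close>

definition sq_projs :: "('o, 'm) cat \<Rightarrow> 'o \<Rightarrow> 'm \<times> 'm" where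
  "sq_projs C X = (SOME (p, q). is_product C X X p q)"

definition pr0 :: "('o, 'm) cat \<Rightarrow> 'o \<Rightarrow> 'm" where
  "pr0 C X = fst (sq_projs C X)"

definition pr1 :: "('o, 'm) cat \<Rightarrow> 'o \<Rightarrow> 'm" where
  "pr1 C X = snd (sq_projs C X)"

definition sq :: "('o, 'm) cat \<Rightarrow> 'o \<Rightarrow> 'o" where
  "sq C X = Dom C (pr0 C X)"

definition pairing :: "('o, 'm) cat \<Rightarrow> 'o \<Rightarrow> 'm \<Rightarrow> 'm \<Rightarrow> 'm" where
  "pairing C X u v =
     (THE w. w \<in> hom C (Dom C u) (sq C X) \<and> pr0 C X \<cdot>\<^bsub>C\<^esub> w = u \<and> pr1 C X \<cdot>\<^bsub>C\<^esub> w = v)"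

text \<open>\<open>f \<times> f : X \<times> X \<rightarrow> Y \<times> Y\<close> for \<open>f : X \<rightarrow> Y\<close>.\<close>

definition sq_map :: "('o, 'm) cat \<Rightarrow> 'm \<Rightarrow> 'm" where
  "sq_map C f =
     pairing C (Cod C f) (f \<cdot>\<^bsub>C\<^esub> pr0 C (Dom C f)) (f \<cdot>\<^bsub>C\<^esub> pr1 C (Dom C f))"

text \<open>A subobject is an isomorphism class of monomorphisms into a fixed object, so it is
  an element of type \<open>'m set\<close>.\<close>

definition sub_iso :: "('o, 'm) cat \<Rightarrow> 'o \<Rightarrow> ('m \<times> 'm) set" where
  "sub_iso C a = {(m, n). monic C m \<and> Cod C m = a \<and> monic C n \<and> Cod C n = a \<and>
     (\<exists>i\<in>hom C (Dom C m) (Dom C n). is_iso C i \<and> n \<cdot>\<^bsub>C\<^esub> i = m)}"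

definition subobjects :: "('o, 'm) cat \<Rightarrow> 'o \<Rightarrow> 'm set set" where
  "subobjects C a = {m. monic C m \<and> Cod C m = a} // sub_iso C a"

definition sub_le :: "('o, 'm) cat \<Rightarrow> 'm set \<Rightarrow> 'm set \<Rightarrow> bool" where
  "sub_le C R S \<longleftrightarrow> (\<exists>m\<in>R. \<exists>n\<in>S. \<exists>k\<in>hom C (Dom C m) (Dom C n). n \<cdot>\<^bsub>C\<^esub> k = m)"

definition relations :: "('o, 'm) cat \<Rightarrow> 'o \<Rightarrow> 'm set set" where
  "relations C X = subobjects C (sq C X)"

definition diag :: "('o, 'm) cat \<Rightarrow> 'o \<Rightarrow> 'm set" where
  "diag C X = sub_iso C (sq C X) `` {pairing C X (Idn C X) (Idn C X)}"

definition rel_op :: "('o, 'm) cat \<Rightarrow> 'o \<Rightarrow> 'm set \<Rightarrow> 'm set" where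
  "rel_op C X R = (\<lambda>r. pairing C X (pr1 C X \<cdot>\<^bsub>C\<^esub> r) (pr0 C X \<cdot>\<^bsub>C\<^esub> r)) ` R"

text \<open>The composite \<open>S \<circ> R\<close> (first \<open>R\<close>, then \<open>S\<close>): its representatives are the monic parts
  \<open>m\<close> of the regular epi-mono factorizations \<open>m \<cdot> e\<close> of the map
  \<open>R \<times>\<^sub>X S \<rightarrow> X \<times> X\<close>, for all choices of representatives, pullback and factorization.\<close>

definition rel_comp :: "('o, 'm) cat \<Rightarrow> 'o \<Rightarrow> 'm set \<Rightarrow> 'm set \<Rightarrow> 'm set" where
  "rel_comp C X S R = {m. monic C m \<and> Cod C m = sq C X \<and>
     (\<exists>r\<in>R. \<exists>s\<in>S. \<exists>p q e.
        is_pullback C (pr1 C X \<cdot>\<^bsub>C\<^esub> r) (pr0 C X \<cdot>\<^bsub>C\<^esub> s) p q \<and>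
        regular_epi C e \<and> e \<in> hom C (Dom C p) (Dom C m) \<and>
        m \<cdot>\<^bsub>C\<^esub> e = pairing C X (pr0 C X \<cdot>\<^bsub>C\<^esub> r \<cdot>\<^bsub>C\<^esub> p) (pr1 C X \<cdot>\<^bsub>C\<^esub> s \<cdot>\<^bsub>C\<^esub> q))}"

text \<open>\<open>f\<^sup>-\<^sup>1(S)\<close>: the set of all pullbacks of representatives of \<open>S\<close> along \<open>f \<times> f\<close>.\<close>

definition rel_inv_image :: "('o, 'm) cat \<Rightarrow> 'm \<Rightarrow> 'm set \<Rightarrow> 'm set" where
  "rel_inv_image C f S = {m. \<exists>s\<in>S. \<exists>q. is_pullback C (sq_map C f) s m q}"

definition reflexive_rels :: "('o, 'm) cat \<Rightarrow> 'o \<Rightarrow> 'm set set" where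
  "reflexive_rels C X = {R \<in> relations C X. sub_le C (diag C X) R}"

definition symmetric_rel :: "('o, 'm) cat \<Rightarrow> 'o \<Rightarrow> 'm set \<Rightarrow> bool" where
  "symmetric_rel C X R \<longleftrightarrow> sub_le C (rel_op C X R) R"

definition transitive_rel :: "('o, 'm) cat \<Rightarrow> 'o \<Rightarrow> 'm set \<Rightarrow> bool" where
  "transitive_rel C X R \<longleftrightarrow> sub_le C (rel_comp C X R R) R"

definition preorder_rel :: "('o, 'm) cat \<Rightarrow> 'o \<Rightarrow> 'm set \<Rightarrow> bool" where
  "preorder_rel C X R \<longleftrightarrow> R \<in> reflexive_rels C X \<and> transitive_rel C X R"

definition equivalence_rel :: "('o, 'm) cat \<Rightarrow> 'o \<Rightarrow> 'm set \<Rightarrow> bool" where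
  "equivalence_rel C X R \<longleftrightarrow> preorder_rel C X R \<and> symmetric_rel C X R"

section \<open>The categories of reflexive relations, preorders and equivalence relations\<close>

text \<open>A morphism carries its source and target, as the same map of the base category may
  underlie morphisms between different relations.\<close>

definition RefCat ::
  "('o, 'm) cat \<Rightarrow> ('o \<times> 'm set, ('o \<times> 'm set) \<times> 'm \<times> ('o \<times> 'm set)) cat" where
  "RefCat C = \<lparr>
     Ob = {(X, R). X \<in> Ob C \<and> R \<in> reflexive_rels C X},
     Ar = {((X, R), f, (Y, S)). X \<in> Ob C \<and> R \<in> reflexive_rels C X \<and>
             Y \<in> Ob C \<and> S \<in> reflexive_rels C Y \<and>
             f \<in> hom C X Y \<and> sub_le C R (rel_inv_image C f S)},
     Dom = (\<lambda>(a, f, b). a),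
     Cod = (\<lambda>(a, f, b). b),
     Idn = (\<lambda>a. (a, Idn C (fst a), a)),
     Comp = (\<lambda>(b', g, c) (a, f, b). (a, g \<cdot>\<^bsub>C\<^esub> f, c))\<rparr>"

definition PrOCat ::
  "('o, 'm) cat \<Rightarrow> ('o \<times> 'm set, ('o \<times> 'm set) \<times> 'm \<times> ('o \<times> 'm set)) cat" where
  "PrOCat C = full_subcat (RefCat C) (\<lambda>(X, R). preorder_rel C X R)"

definition EquCat ::
  "('o, 'm) cat \<Rightarrow> ('o \<times> 'm set, ('o \<times> 'm set) \<times> 'm \<times> ('o \<times> 'm set)) cat" where
  "EquCat C = full_subcat (RefCat C) (\<lambda>(X, R). equivalence_rel C X R)"

section \<open>Suprema of chains of reflexive relations\<close>

definition refl_chain :: "('o, 'm) cat \<Rightarrow> 'o \<Rightarrow> (nat \<Rightarrow> 'm set) \<Rightarrow> bool" where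
  "refl_chain C X R \<longleftrightarrow>
     (\<forall>i. R i \<in> reflexive_rels C X) \<and> (\<forall>i j. i \<le> j \<longrightarrow> sub_le C (R i) (R j))"

definition is_refl_sup :: "('o, 'm) cat \<Rightarrow> 'o \<Rightarrow> (nat \<Rightarrow> 'm set) \<Rightarrow> 'm set \<Rightarrow> bool" where
  "is_refl_sup C X R S \<longleftrightarrow> S \<in> reflexive_rels C X \<and> (\<forall>i. sub_le C (R i) S) \<and>
     (\<forall>T\<in>reflexive_rels C X. (\<forall>i. sub_le C (R i) T) \<longrightarrow> sub_le C S T)"

definition refl_sup :: "('o, 'm) cat \<Rightarrow> 'o \<Rightarrow> (nat \<Rightarrow> 'm set) \<Rightarrow> 'm set" where
  "refl_sup C X R = (THE S. is_refl_sup C X R S)"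

definition has_chain_sups :: "('o, 'm) cat \<Rightarrow> bool" where
  "has_chain_sups C \<longleftrightarrow>
     (\<forall>X\<in>Ob C. \<forall>R. refl_chain C X R \<longrightarrow> (\<exists>S. is_refl_sup C X R S))"

definition chain_sups_comp_stable :: "('o, 'm) cat \<Rightarrow> bool" where
  "chain_sups_comp_stable C \<longleftrightarrow>
     (\<forall>X\<in>Ob C. \<forall>R. \<forall>T\<in>reflexive_rels C X. refl_chain C X R \<longrightarrow>
        refl_sup C X (\<lambda>i. rel_comp C X (R i) T) = rel_comp C X (refl_sup C X R) T)"

end

theory Submission imports Defs begin

text \<open>A reflexive relation \<open>R\<close> generates a preorder by iterated squaring: put \<open>R\<^sub>0 = R\<close>,
  \<open>R\<^sub>n\<^sub>+\<^sub>1 = R\<^sub>n R\<^sub>n\<close>, and let \<open>S\<close> be the supremum of this chain. Two members of the chain compose to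
  something below \<open>S\<close>, because both lie below a common \<open>R\<^sub>k\<close> and \<open>R\<^sub>k R\<^sub>k = R\<^sub>k\<^sub>+\<^sub>1\<close>; with squares this is just
  monotonicity of composition. If composition
  preserves the supremum in each variable, it follows that \<open>S S \<subset> S\<close>. Stability in the left
  variable is assumed, and stability in the right variable follows from it because passing to
  opposites reverses composites and preserves order (\<open>comp_refl_sup_le\<close>). A preorder containing \<open>R\<close>
  contains every \<open>R\<^sub>n\<close>, hence \<open>S\<close>.

  For equivalence relations, start from \<open>Q = R R\<^sup>o\<^sup>p\<close>, which is symmetric and contained in every
  equivalence relation above \<open>R\<close>. The preorder generated by a symmetric relation is symmetric,
  since its opposite is again a preorder containing that relation.

  Inverse images of preorders and of equivalence relations are of the same kind. Therefore, when
  \<open>f : X \<rightarrow> Y\<close> is a morphism from \<open>R\<close> to a preorder \<open>T\<close>, the relation \<open>f\<^sup>-\<^sup>1(T)\<close> is a preorder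
  above \<open>R\<close> and so above the closure of \<open>R\<close>; that is, \<open>f\<close> is also a morphism from the closure. This
  makes the closure a reflection whose unit is carried by the identity of \<open>X\<close>
  (\<open>closure_left_adjoint\<close>).

  All calculations with relations are done on generalized elements: \<open>rel_mem C X R u v\<close> says
  that \<open>(u, v) : A \<rightarrow> X \<times> X\<close> factors through \<open>R\<close>. In a regular category, \<open>(u, v)\<close> belongs to \<open>S R\<close>
  exactly when, after composition with some regular epimorphism \<open>e\<close>, there is a middle element \<open>w\<close>
  with \<open>(u e, w)\<close> in \<open>R\<close> and \<open>(w, v e)\<close> in \<open>S\<close> (\<open>rel_comp_mem_rep\<close>). Since membership descends
  along regular epimorphisms, an inclusion \<open>S R \<subset> T\<close> may be checked as for relations between sets
  (\<open>rel_comp_le_iff\<close>).\<close>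

section \<open>Arrows, monomorphisms and products\<close>

context category
begin

lemma comp_simps [simp]:
  assumes "f \<in> Ar C" "g \<in> Ar C" "Cod C f = Dom C g"
  shows "g \<cdot> f \<in> Ar C" "Dom C (g \<cdot> f) = Dom C f" "Cod C (g \<cdot> f) = Cod C g"
  using comp_hom[of f "Dom C f" "Dom C g" g "Cod C g"] assms by (auto simp: hom_def)

lemma comp_assoc_Ar [simp]:
  assumes "f \<in> Ar C" "g \<in> Ar C" "h \<in> Ar C" "Cod C f = Dom C g" "Cod C g = Dom C h"
  shows "(h \<cdot> g) \<cdot> f = h \<cdot> (g \<cdot> f)"
  using comp_assoc[of f "Dom C f" "Dom C g" g "Dom C h" h "Cod C h"] assms
  by (auto simp: hom_def)

lemma idn_simps [simp]:
  assumes "a \<in> Ob C"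
  shows "Idn C a \<in> Ar C" "Dom C (Idn C a) = a" "Cod C (Idn C a) = a"
  using idn_hom[OF assms] by (auto simp: hom_def)

lemma comp_idn [simp]:
  assumes "f \<in> Ar C"
  shows "Dom C f = a \<Longrightarrow> f \<cdot> Idn C a = f" "Cod C f = b \<Longrightarrow> Idn C b \<cdot> f = f"
  using comp_idn_right[of f "Dom C f" "Cod C f"] comp_idn_left[of f "Dom C f" "Cod C f"] assms
  by (auto simp: hom_def)

text \<open>As composites are normalized to the right, an equation \<open>g f = h\<close> no longer matches inside
  \<open>g (f k)\<close>; this lemma and its variant for three factors supply the missing instance.\<close>

lemma precomp_eq:
  assumes "g \<cdot> f = h" "f \<in> Ar C" "g \<in> Ar C" "k \<in> Ar C" "Cod C f = Dom C g" "Cod C k = Dom C f"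
  shows "g \<cdot> (f \<cdot> k) = h \<cdot> k"
  using assms by (metis comp_assoc_Ar)

lemma monic_cancel:
  assumes "monic C m" "m \<cdot> u = m \<cdot> v" "u \<in> hom C a (Dom C m)" "v \<in> hom C a (Dom C m)"
  shows "u = v"
  using assms unfolding monic_def by blast

lemma regular_epi_Ar: "regular_epi C e \<Longrightarrow> e \<in> Ar C"
  by (auto simp: regular_epi_def is_coequalizer_def hom_def)

lemma regular_epi_cancel:
  assumes "regular_epi C e" "u \<cdot> e = v \<cdot> e" "u \<in> hom C (Cod C e) a" "v \<in> hom C (Cod C e) a"
  shows "u = v"
proof -
  obtain x y where xy: "is_coequalizer C x y e"
    using assms(1) by (auto simp: regular_epi_def)
  have e: "e \<in> Ar C" "Dom C e = Cod C x" "x \<in> Ar C" "y \<in> Ar C" "Cod C y = Cod C x"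
    "e \<cdot> x = e \<cdot> y" "Dom C y = Dom C x"
    using xy by (auto simp: is_coequalizer_def hom_def)
  have "u \<cdot> e \<in> hom C (Cod C x) a" "(u \<cdot> e) \<cdot> x = (u \<cdot> e) \<cdot> y"
    using e assms(3) by (auto simp: hom_def)
  then have "\<exists>!w. w \<in> hom C (Cod C e) a \<and> w \<cdot> e = u \<cdot> e"
    using xy unfolding is_coequalizer_def by blast
  then show ?thesis using assms by metis
qed

text \<open>Regular epimorphisms are left orthogonal to monomorphisms. This is what lets a relation
  be tested after covering the stage of definition by a regular epimorphism.\<close>

lemma regular_epi_diagonal:
  assumes "regular_epi C e" "monic C m" "m \<cdot> g = h \<cdot> e"
    and "e \<in> hom C B A" "g \<in> hom C B (Dom C m)" "h \<in> hom C A (Cod C m)"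
  shows "\<exists>k \<in> hom C A (Dom C m). m \<cdot> k = h"
proof -
  obtain x y where xy: "is_coequalizer C x y e"
    using assms(1) by (auto simp: regular_epi_def)
  have e: "e \<in> Ar C" "Dom C e = Cod C x" "x \<in> Ar C" "y \<in> Ar C" "Cod C y = Cod C x"
    "e \<cdot> x = e \<cdot> y" "Dom C y = Dom C x"
    using xy by (auto simp: is_coequalizer_def hom_def)
  have m: "m \<in> Ar C" using assms(2) by (simp add: monic_def)
  have AB: "B = Cod C x" "A = Cod C e" using assms(4) e by (auto simp: hom_def)
  have "m \<cdot> (g \<cdot> x) = h \<cdot> (e \<cdot> x)" "m \<cdot> (g \<cdot> y) = h \<cdot> (e \<cdot> y)"
    using precomp_eq[OF assms(3), of x] precomp_eq[OF assms(3), of y] e m assms(4-6) AB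
    by (auto simp: hom_def)
  then have "m \<cdot> (g \<cdot> x) = m \<cdot> (g \<cdot> y)" using e by simp
  then have "g \<cdot> x = g \<cdot> y"
    by (rule monic_cancel[OF assms(2)]) (use assms(5) e AB in \<open>auto simp: hom_def\<close>)
  then have "\<exists>!w. w \<in> hom C (Cod C e) (Dom C m) \<and> w \<cdot> e = g"
    using xy assms(5) AB unfolding is_coequalizer_def by blast
  then obtain k where k: "k \<in> hom C A (Dom C m)" "k \<cdot> e = g" using AB by blast
  have "(m \<cdot> k) \<cdot> e = h \<cdot> e"
    using k m e assms(3) AB by (auto simp: hom_def)
  then have "m \<cdot> k = h"
    by (rule regular_epi_cancel[OF assms(1)]) (use k m assms(6) AB in \<open>auto simp: hom_def\<close>)
  then show ?thesis using k by blast
qed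

lemma idn_regular_epi:
  assumes "a \<in> Ob C" shows "regular_epi C (Idn C a)"
proof -
  have "is_coequalizer C (Idn C a) (Idn C a) (Idn C a)"
    unfolding is_coequalizer_def using assms by (auto simp: hom_def)
  then show ?thesis by (auto simp: regular_epi_def)
qed

text \<open>Needed because a composite relation is the set of all monic parts of regular epi-mono
  factorizations: replacing the monic part by an isomorphic one composes the epic part with an
  isomorphism.\<close>

lemma iso_comp_regular_epi:
  assumes "regular_epi C e" "is_iso C i" "Cod C e = Dom C i"
  shows "regular_epi C (i \<cdot> e)"
proof -
  obtain x y where xy: "is_coequalizer C x y e"
    using assms(1) by (auto simp: regular_epi_def)
  have e: "e \<in> Ar C" "Dom C e = Cod C x" "x \<in> Ar C" "y \<in> Ar C" "Cod C y = Cod C x"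
    "e \<cdot> x = e \<cdot> y" "Dom C y = Dom C x"
    using xy by (auto simp: is_coequalizer_def hom_def)
  obtain j where i: "i \<in> Ar C" and j: "j \<in> Ar C" "Dom C j = Cod C i" "Cod C j = Dom C i"
    "j \<cdot> i = Idn C (Dom C i)" "i \<cdot> j = Idn C (Cod C i)"
    using assms(2) by (auto simp: is_iso_def hom_def)
  have "is_coequalizer C x y (i \<cdot> e)"
    unfolding is_coequalizer_def
  proof (intro conjI allI ballI impI)
    fix a h assume h: "h \<in> hom C (Cod C x) a" "h \<cdot> x = h \<cdot> y"
    then have "\<exists>!w. w \<in> hom C (Cod C e) a \<and> w \<cdot> e = h"
      using xy unfolding is_coequalizer_def by blast
    then obtain w where w: "w \<in> Ar C" "Dom C w = Cod C e" "Cod C w = a" "w \<cdot> e = h"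
      by (auto simp: hom_def)
    have "j \<cdot> (i \<cdot> e) = e"
      using precomp_eq[OF j(4), of e] i j e assms(3) cod_ob[of e] by simp
    then have ex: "(w \<cdot> j) \<in> hom C (Cod C (i \<cdot> e)) a \<and> (w \<cdot> j) \<cdot> (i \<cdot> e) = h"
      using w i j e assms(3) by (auto simp: hom_def)
    show "\<exists>!v. v \<in> hom C (Cod C (i \<cdot> e)) a \<and> v \<cdot> (i \<cdot> e) = h"
    proof (rule ex1I[where a = "w \<cdot> j"], rule ex)
      fix v assume v: "v \<in> hom C (Cod C (i \<cdot> e)) a \<and> v \<cdot> (i \<cdot> e) = h"
      then have v': "v \<in> Ar C" "Dom C v = Cod C i" "Cod C v = a" using i e assms(3)
        by (auto simp: hom_def)
      have "(v \<cdot> i) \<cdot> e = w \<cdot> e" using v v' i e assms(3) w by simp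
      then have "v \<cdot> i = w"
        by (rule regular_epi_cancel[OF assms(1)])
          (use v' i e assms(3) w in \<open>auto simp: hom_def\<close>)
      then have "w \<cdot> j = v \<cdot> (i \<cdot> j)" using v' i j by auto
      then show "v = w \<cdot> j" using j v' by simp
    qed
  qed (use e i assms(3) in \<open>auto simp: hom_def\<close>)
  then show ?thesis by (auto simp: regular_epi_def)
qed

end

context regular_category
begin

text \<open>A product is a pullback over the terminal object.\<close>

lemma ex_product:
  assumes "a \<in> Ob C" "b \<in> Ob C"
  shows "\<exists>p q. is_product C a b p q"
proof -
  obtain t where t: "t \<in> Ob C" "\<And>x. x \<in> Ob C \<Longrightarrow> \<exists>!f. f \<in> hom C x t"
    using ex_terminal by (auto simp: is_terminal_def)
  obtain f g where fg: "f \<in> hom C a t" "g \<in> hom C b t"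
    using t assms by metis
  then obtain p q where pb: "is_pullback C f g p q"
    using ex_pullback[of f g] by (auto simp: hom_def)
  have "f \<cdot> u = g \<cdot> v" if "u \<in> hom C x a" "v \<in> hom C x b" for x u v
  proof -
    have "x \<in> Ob C" using that dom_ob[of u] by (auto simp: hom_def)
    moreover have "f \<cdot> u \<in> hom C x t" "g \<cdot> v \<in> hom C x t"
      using that fg by (auto simp: hom_def)
    ultimately show ?thesis using t(2) by blast
  qed
  then have "is_product C a b p q"
    using pb fg unfolding is_product_def is_pullback_def by (simp add: hom_def)
  then show ?thesis by blast
qed

lemma sq_product:
  assumes "X \<in> Ob C" shows "is_product C X X (pr0 C X) (pr1 C X)"
proof -
  have "\<exists>z. case z of (p, q) \<Rightarrow> is_product C X X p q"
    using ex_product[OF assms assms] by auto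
  then have "case sq_projs C X of (p, q) \<Rightarrow> is_product C X X p q"
    unfolding sq_projs_def by (rule someI_ex)
  then show ?thesis by (simp add: pr0_def pr1_def split: prod.splits)
qed

lemma pr_simps [simp]:
  assumes "X \<in> Ob C"
  shows "pr0 C X \<in> Ar C" "pr1 C X \<in> Ar C" "Dom C (pr0 C X) = sq C X" "Dom C (pr1 C X) = sq C X"
    "Cod C (pr0 C X) = X" "Cod C (pr1 C X) = X"
  using sq_product[OF assms] by (auto simp: is_product_def hom_def sq_def)

lemma sq_ext:
  assumes "X \<in> Ob C" "w \<in> hom C A (sq C X)" "w' \<in> hom C A (sq C X)"
    and "pr0 C X \<cdot> w = pr0 C X \<cdot> w'" "pr1 C X \<cdot> w = pr1 C X \<cdot> w'"
  shows "w = w'"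
proof -
  have "pr0 C X \<cdot> w \<in> hom C A X" "pr1 C X \<cdot> w \<in> hom C A X"
    using assms(1,2) by (auto simp: hom_def)
  then have "\<exists>!z. z \<in> hom C A (sq C X) \<and> pr0 C X \<cdot> z = pr0 C X \<cdot> w \<and> pr1 C X \<cdot> z = pr1 C X \<cdot> w"
    using sq_product[OF assms(1)] unfolding is_product_def sq_def by blast
  then show ?thesis using assms by metis
qed

lemma pairing_simps:
  assumes "X \<in> Ob C" "u \<in> hom C A X" "v \<in> hom C A X"
  shows "pairing C X u v \<in> hom C A (sq C X)"
    "pr0 C X \<cdot> pairing C X u v = u" "pr1 C X \<cdot> pairing C X u v = v"
proof -
  have "\<exists>!z. z \<in> hom C A (sq C X) \<and> pr0 C X \<cdot> z = u \<and> pr1 C X \<cdot> z = v"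
    using sq_product[OF assms(1)] assms(2,3) unfolding is_product_def sq_def by blast
  moreover have "Dom C u = A" using assms(2) by (simp add: hom_def)
  ultimately have "pairing C X u v \<in> hom C A (sq C X) \<and> pr0 C X \<cdot> pairing C X u v = u
      \<and> pr1 C X \<cdot> pairing C X u v = v"
    unfolding pairing_def by (simp, rule_tac theI')
  then show "pairing C X u v \<in> hom C A (sq C X)"
    "pr0 C X \<cdot> pairing C X u v = u" "pr1 C X \<cdot> pairing C X u v = v" by auto
qed

lemma regular_epi_pullback:
  assumes "regular_epi C e" "k \<in> hom C A (Cod C e)"
  obtains B e' k' where "regular_epi C e'" "e' \<in> hom C B A" "k' \<in> hom C B (Dom C e)"
    "e \<cdot> k' = k \<cdot> e'"
proof -
  have "\<exists>p q. is_pullback C k e p q"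
    using ex_pullback[of k e] assms regular_epi_Ar by (auto simp: hom_def)
  then obtain p q where pq: "is_pullback C k e p q" by blast
  show ?thesis
    by (rule that[of p "Dom C p" q])
      (use pq assms regular_epi_stable[OF pq] in \<open>auto simp: is_pullback_def hom_def\<close>)
qed

text \<open>The coequalizer of the kernel pair of \<open>f\<close> leaves a monic factor: two arrows identified by
  that factor lift to the domain of \<open>f\<close> along regular epimorphisms, where the lifts lie in the
  kernel pair.\<close>

lemma image_factorization:
  assumes f: "f \<in> hom C P Q"
  obtains m e where "monic C m" "regular_epi C e" "e \<in> hom C P (Dom C m)" "Cod C m = Q"
    "m \<cdot> e = f"
proof -
  have f': "f \<in> Ar C" "Dom C f = P" "Cod C f = Q" using f by (auto simp: hom_def)
  obtain p q where pq: "is_pullback C f f p q" using ex_pullback[of f f] f' by auto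
  then obtain e where e: "is_coequalizer C p q e" using kernel_pair_coequalizer by blast
  have re: "regular_epi C e" using e by (auto simp: regular_epi_def)
  have pq': "p \<in> Ar C" "q \<in> Ar C" "Dom C q = Dom C p" "Cod C p = P" "Cod C q = P"
    "f \<cdot> p = f \<cdot> q"
    using pq f' by (auto simp: is_pullback_def hom_def)
  have e': "e \<in> Ar C" "Dom C e = P" "e \<cdot> p = e \<cdot> q"
    using e pq' by (auto simp: is_coequalizer_def hom_def)
  have "\<exists>!w. w \<in> hom C (Cod C e) Q \<and> w \<cdot> e = f"
    using e f pq' unfolding is_coequalizer_def by blast
  then obtain m where m: "m \<in> Ar C" "Dom C m = Cod C e" "Cod C m = Q" "m \<cdot> e = f"
    by (auto simp: hom_def)
  have "monic C m"
    unfolding monic_def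
  proof (intro conjI allI ballI impI)
    fix a u v assume u: "u \<in> hom C a (Dom C m)" and v: "v \<in> hom C a (Dom C m)"
      and uv: "m \<cdot> u = m \<cdot> v"
    have u': "u \<in> Ar C" "Dom C u = a" "Cod C u = Cod C e" using u m by (auto simp: hom_def)
    have v': "v \<in> Ar C" "Dom C v = a" "Cod C v = Cod C e" using v m by (auto simp: hom_def)
    obtain B e1 x where e1: "regular_epi C e1" "e1 \<in> hom C B a" "x \<in> hom C B (Dom C e)"
      "e \<cdot> x = u \<cdot> e1"
      using regular_epi_pullback[OF re] u m by metis
    have E1: "e1 \<in> Ar C" "Dom C e1 = B" "Cod C e1 = a" "x \<in> Ar C" "Dom C x = B" "Cod C x = P"
      using e1 e' by (auto simp: hom_def)
    have "v \<cdot> e1 \<in> hom C B (Cod C e)" using v' E1 by (auto simp: hom_def)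
    then obtain D e2 y where e2: "regular_epi C e2" "e2 \<in> hom C D B" "y \<in> hom C D (Dom C e)"
      "e \<cdot> y = (v \<cdot> e1) \<cdot> e2"
      using regular_epi_pullback[OF re] by metis
    have E2: "e2 \<in> Ar C" "Dom C e2 = D" "Cod C e2 = B" "y \<in> Ar C" "Dom C y = D" "Cod C y = P"
      using e2 e' by (auto simp: hom_def)
    have ex: "e \<cdot> (x \<cdot> e2) = (u \<cdot> e1) \<cdot> e2"
      by (rule precomp_eq[OF e1(4)]) (use E1 E2 e' in auto)
    have "f \<cdot> (x \<cdot> e2) = m \<cdot> (e \<cdot> (x \<cdot> e2))"
      by (rule precomp_eq[OF m(4), symmetric]) (use E1 E2 e' m in auto)
    also have "\<dots> = (m \<cdot> u) \<cdot> (e1 \<cdot> e2)" using ex u' E1 E2 m by simp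
    also have "\<dots> = m \<cdot> (e \<cdot> y)" using uv e2(4) v' E1 E2 m by simp
    also have "\<dots> = f \<cdot> y"
      by (rule precomp_eq[OF m(4)]) (use E1 E2 e' m in auto)
    finally have fxy: "f \<cdot> (x \<cdot> e2) = f \<cdot> y" .
    have "x \<cdot> e2 \<in> hom C D (Dom C f)" "y \<in> hom C D (Dom C f)"
      using E1 E2 f' by (auto simp: hom_def)
    then have "\<exists>!w. w \<in> hom C D (Dom C p) \<and> p \<cdot> w = x \<cdot> e2 \<and> q \<cdot> w = y"
      using pq fxy unfolding is_pullback_def by blast
    then obtain w where w: "w \<in> Ar C" "Dom C w = D" "Cod C w = Dom C p" "p \<cdot> w = x \<cdot> e2" "q \<cdot> w = y"
      by (auto simp: hom_def)
    have "e \<cdot> (p \<cdot> w) = (e \<cdot> q) \<cdot> w"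
      by (rule precomp_eq[OF e'(3)]) (use w e' pq' in auto)
    also have "\<dots> = e \<cdot> (q \<cdot> w)" using w e' pq' by simp
    finally have "e \<cdot> (x \<cdot> e2) = e \<cdot> y" using w by simp
    then have "(u \<cdot> e1) \<cdot> e2 = (v \<cdot> e1) \<cdot> e2" using ex e2(4) by simp
    then have "u \<cdot> e1 = v \<cdot> e1"
      by (rule regular_epi_cancel[OF e2(1)]) (use E1 E2 u' v' in \<open>auto simp: hom_def\<close>)
    then show "u = v"
      by (rule regular_epi_cancel[OF e1(1)]) (use E1 u' v' in \<open>auto simp: hom_def\<close>)
  qed (use m in auto)
  then show ?thesis using re m e' by (intro that[of m e]) (auto simp: hom_def)
qed

end

section \<open>Generalized elements of relations\<close>

text \<open>Here \<open>(u, v)\<close> is a generalized element of \<open>R\<close>. Its typing is implicit: since the pair is given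
  as \<open>r k\<close>, the arrows \<open>u\<close> and \<open>v\<close> have codomain \<open>X\<close> and the same domain.\<close>

definition rel_mem :: "('o, 'm) cat \<Rightarrow> 'o \<Rightarrow> 'm set \<Rightarrow> 'm \<Rightarrow> 'm \<Rightarrow> bool" where
  "rel_mem C X R u v \<longleftrightarrow> (\<exists>r\<in>R. \<exists>k\<in>Ar C. Cod C k = Dom C r \<and>
     pr0 C X \<cdot>\<^bsub>C\<^esub> r \<cdot>\<^bsub>C\<^esub> k = u \<and> pr1 C X \<cdot>\<^bsub>C\<^esub> r \<cdot>\<^bsub>C\<^esub> k = v)"

definition factors :: "('o, 'm) cat \<Rightarrow> 'm \<Rightarrow> 'm \<Rightarrow> bool" where
  "factors C n m \<longleftrightarrow> (\<exists>k\<in>hom C (Dom C n) (Dom C m). m \<cdot>\<^bsub>C\<^esub> k = n)"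

text \<open>The part of being a relation that suffices for elementwise arguments: any representative may
  be used in place of any other. Composites, opposites and inverse images are first shown to have
  this property, which gives access to their elements, and then to be full isomorphism classes.\<close>

definition mono_class :: "('o, 'm) cat \<Rightarrow> 'o \<Rightarrow> 'm set \<Rightarrow> bool" where
  "mono_class C X R \<longleftrightarrow> R \<noteq> {} \<and> (\<forall>m\<in>R. monic C m \<and> Cod C m = sq C X) \<and>
     (\<forall>m\<in>R. \<forall>n\<in>R. factors C n m)"

context category
begin

lemma factors_trans:
  assumes "factors C l m" "factors C m n" "n \<in> Ar C"
  shows "factors C l n"
proof -
  obtain j k where "j \<in> hom C (Dom C l) (Dom C m)" "m \<cdot> j = l"
    "k \<in> hom C (Dom C m) (Dom C n)" "n \<cdot> k = m"
    using assms by (auto simp: factors_def)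
  then have "k \<cdot> j \<in> hom C (Dom C l) (Dom C n)" "n \<cdot> (k \<cdot> j) = l"
    using assms(3) precomp_eq[of n k m j] by (auto simp: hom_def)
  then show ?thesis by (auto simp: factors_def)
qed

lemma factors_refl: "n \<in> Ar C \<Longrightarrow> factors C n n"
  unfolding factors_def by (rule bexI[of _ "Idn C (Dom C n)"]) (auto simp: hom_def dom_ob)

lemma factors_both_iso:
  assumes "monic C m" "monic C n" "factors C m n" "factors C n m"
  shows "\<exists>i\<in>hom C (Dom C m) (Dom C n). is_iso C i \<and> n \<cdot> i = m"
proof -
  obtain j k where j: "j \<in> hom C (Dom C n) (Dom C m)" "m \<cdot> j = n"
    and k: "k \<in> hom C (Dom C m) (Dom C n)" "n \<cdot> k = m"
    using assms by (auto simp: factors_def)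
  have mn: "m \<in> Ar C" "n \<in> Ar C" using assms by (auto simp: monic_def)
  have "m \<cdot> (j \<cdot> k) = m \<cdot> Idn C (Dom C m)" "n \<cdot> (k \<cdot> j) = n \<cdot> Idn C (Dom C n)"
    using precomp_eq[OF j(2), of k] precomp_eq[OF k(2), of j] mn j k by (auto simp: hom_def)
  then have "j \<cdot> k = Idn C (Dom C m)" "k \<cdot> j = Idn C (Dom C n)"
    using monic_cancel[OF assms(1), of "j \<cdot> k" "Idn C (Dom C m)" "Dom C m"]
      monic_cancel[OF assms(2), of "k \<cdot> j" "Idn C (Dom C n)" "Dom C n"] mn j k
    by (auto simp: hom_def dom_ob)
  then have "is_iso C k" using j k by (auto simp: is_iso_def hom_def)
  then show ?thesis using k by blast
qed

lemma sub_iso_iff: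
  "(m, n) \<in> sub_iso C a \<longleftrightarrow> monic C m \<and> Cod C m = a \<and> monic C n \<and> Cod C n = a \<and>
     factors C m n \<and> factors C n m" (is "?L \<longleftrightarrow> ?R")
proof
  assume ?L
  then obtain i j where mn: "monic C m" "Cod C m = a" "monic C n" "Cod C n = a"
    and i: "i \<in> hom C (Dom C m) (Dom C n)" "n \<cdot> i = m"
    and j: "j \<in> hom C (Dom C n) (Dom C m)" "i \<cdot> j = Idn C (Dom C n)"
    by (auto simp: sub_iso_def is_iso_def hom_def)
  have "n \<cdot> (i \<cdot> j) = m \<cdot> j"
    by (rule precomp_eq[OF i(2)]) (use i(1) j(1) mn in \<open>auto simp: monic_def hom_def\<close>)
  then have "m \<cdot> j = n" using j(2) mn by (simp add: monic_def)
  then show ?R using mn i j by (auto simp: factors_def)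
next
  assume ?R
  then show ?L using factors_both_iso[of m n] by (auto simp: sub_iso_def)
qed

end

context regular_category
begin

lemma relations_mono_class:
  assumes "R \<in> relations C X" shows "mono_class C X R"
proof -
  obtain m where m: "monic C m" "Cod C m = sq C X" "R = sub_iso C (sq C X) `` {m}"
    using assms by (auto simp: relations_def subobjects_def elim!: quotientE)
  then have "m \<in> R" using factors_refl[of m] by (auto simp: sub_iso_iff monic_def)
  moreover have "factors C n n'" if "n \<in> R" "n' \<in> R" for n n'
    using that m factors_trans[of n m n'] by (auto simp: sub_iso_iff monic_def)
  moreover have "monic C n \<and> Cod C n = sq C X" if "n \<in> R" for n
    using that m(3) by (auto simp: sub_iso_iff)
  ultimately show ?thesis unfolding mono_class_def by blast
qed

lemma relations_closed:
  assumes "R \<in> relations C X" "m \<in> R" "monic C n" "Cod C n = sq C X" "factors C m n" "factors C n m"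
  shows "n \<in> R"
proof -
  obtain r where r: "monic C r" "Cod C r = sq C X" "R = sub_iso C (sq C X) `` {r}"
    using assms(1) by (auto simp: relations_def subobjects_def elim!: quotientE)
  have rm: "factors C r m" "factors C m r" "m \<in> Ar C"
    using assms(2) unfolding r(3) by (auto simp: sub_iso_iff monic_def)
  have "factors C r n" "factors C n r"
    using factors_trans[OF rm(1) assms(5)] factors_trans[OF assms(6) rm(2)] r(1) assms(3)
    by (simp_all add: monic_def)
  then show ?thesis using r assms(3,4) by (simp add: sub_iso_iff)
qed

text \<open>A set of mutually isomorphic monomorphisms is a full isomorphism class as soon as it is closed
  under isomorphism.\<close>

lemma relationsI:
  assumes "mono_class C X R"
    and cl: "\<And>m n i. m \<in> R \<Longrightarrow> monic C n \<Longrightarrow> Cod C n = sq C X \<Longrightarrow> is_iso C i \<Longrightarrow>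
       i \<in> hom C (Dom C m) (Dom C n) \<Longrightarrow> n \<cdot> i = m \<Longrightarrow> n \<in> R"
  shows "R \<in> relations C X"
proof -
  obtain m where m: "m \<in> R" using assms by (auto simp: mono_class_def)
  have "R = sub_iso C (sq C X) `` {m}"
  proof (intro equalityI subsetI)
    fix n assume "n \<in> R"
    then show "n \<in> sub_iso C (sq C X) `` {m}"
      using m assms(1) by (auto simp: mono_class_def sub_iso_iff)
  next
    fix n assume n: "n \<in> sub_iso C (sq C X) `` {m}"
    then obtain i where "i\<in>hom C (Dom C m) (Dom C n)" "is_iso C i" "n \<cdot> i = m"
      by (auto simp: sub_iso_def)
    then show "n \<in> R" using cl[OF m] n by (auto simp: sub_iso_iff)
  qed
  moreover have "monic C m" "Cod C m = sq C X" using m assms(1) by (auto simp: mono_class_def)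
  ultimately show ?thesis
    by (auto simp: relations_def subobjects_def intro!: quotientI)
qed

lemma relation_of_mono:
  assumes "monic C m" "Cod C m = sq C X"
  shows "sub_iso C (sq C X) `` {m} \<in> relations C X" "m \<in> sub_iso C (sq C X) `` {m}"
  using assms factors_refl[of m]
  by (auto simp: relations_def subobjects_def sub_iso_iff monic_def intro!: quotientI)

lemma mono_classD:
  assumes "mono_class C X R" "r \<in> R"
  shows "monic C r" "r \<in> Ar C" "Cod C r = sq C X"
  using assms by (auto simp: mono_class_def monic_def)

lemma rel_mem_hom:
  assumes "X \<in> Ob C" "mono_class C X R" "rel_mem C X R u v"
  shows "u \<in> hom C (Dom C u) X" "v \<in> hom C (Dom C u) X"
  using assms mono_classD[OF assms(2)] by (auto simp: rel_mem_def hom_def)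

lemma rel_mem_rep:
  assumes "X \<in> Ob C" "mono_class C X R" "r \<in> R"
  shows "rel_mem C X R u v \<longleftrightarrow>
    (\<exists>k\<in>hom C (Dom C u) (Dom C r). pr0 C X \<cdot> r \<cdot> k = u \<and> pr1 C X \<cdot> r \<cdot> k = v)"
proof
  assume "rel_mem C X R u v"
  then obtain s k where s: "s \<in> R" and k: "k \<in> Ar C" "Cod C k = Dom C s"
    "pr0 C X \<cdot> s \<cdot> k = u" "pr1 C X \<cdot> s \<cdot> k = v" by (auto simp: rel_mem_def)
  obtain j where j: "j \<in> hom C (Dom C s) (Dom C r)" "r \<cdot> j = s"
    using assms(2,3) s unfolding mono_class_def factors_def by blast
  note D = mono_classD[OF assms(2,3)] mono_classD[OF assms(2) s]
  have "Dom C k = Dom C u" using k D assms(1) by (metis comp_simps pr_simps(1,3))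
  then have "j \<cdot> k \<in> hom C (Dom C u) (Dom C r)" using j k by (auto simp: hom_def)
  moreover have "r \<cdot> (j \<cdot> k) = s \<cdot> k"
    by (rule precomp_eq[OF j(2)]) (use j k D in \<open>auto simp: hom_def\<close>)
  ultimately show "\<exists>k\<in>hom C (Dom C u) (Dom C r). pr0 C X \<cdot> r \<cdot> k = u \<and> pr1 C X \<cdot> r \<cdot> k = v"
    using k by (intro bexI[of _ "j \<cdot> k"]) auto
next
  assume "\<exists>k\<in>hom C (Dom C u) (Dom C r). pr0 C X \<cdot> r \<cdot> k = u \<and> pr1 C X \<cdot> r \<cdot> k = v"
  then show "rel_mem C X R u v" using assms(3) by (auto simp: rel_mem_def hom_def)
qed

lemma rel_mem_self:
  assumes "X \<in> Ob C" "mono_class C X R" "r \<in> R"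
  shows "rel_mem C X R (pr0 C X \<cdot> r) (pr1 C X \<cdot> r)"
  unfolding rel_mem_def using mono_classD[OF assms(2,3)] assms
  by (intro bexI[of _ r] bexI[of _ "Idn C (Dom C r)"]) (auto simp: dom_ob)

text \<open>The generic element of a monomorphism \<open>n\<close> is the pair of its own components; it belongs to \<open>R\<close>
  only if \<open>n\<close> factors through \<open>R\<close>. This is the Yoneda argument that turns membership into order.\<close>

lemma factors_if_mem:
  assumes "X \<in> Ob C" "mono_class C X R" "r \<in> R" "n \<in> Ar C" "Cod C n = sq C X"
    and "rel_mem C X R (pr0 C X \<cdot> n) (pr1 C X \<cdot> n)"
  shows "factors C n r"
proof -
  note D = mono_classD[OF assms(2,3)]
  have "Dom C (pr0 C X \<cdot> n) = Dom C n" using assms by simp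
  then obtain k where k: "k \<in> hom C (Dom C n) (Dom C r)" "pr0 C X \<cdot> r \<cdot> k = pr0 C X \<cdot> n"
    "pr1 C X \<cdot> r \<cdot> k = pr1 C X \<cdot> n"
    using assms(6) rel_mem_rep[OF assms(1-3)] by metis
  have "r \<cdot> k = n"
    by (rule sq_ext[OF assms(1) _ _ k(2,3)]) (use k D assms in \<open>auto simp: hom_def\<close>)
  then show ?thesis using k by (auto simp: factors_def)
qed

lemma rel_mem_subst:
  assumes "X \<in> Ob C" "mono_class C X R" "rel_mem C X R u v" "g \<in> hom C B (Dom C u)"
  shows "rel_mem C X R (u \<cdot> g) (v \<cdot> g)"
proof -
  obtain r where r: "r \<in> R" using assms(2) by (auto simp: mono_class_def)
  note D = mono_classD[OF assms(2) r]
  obtain k where k: "k \<in> hom C (Dom C u) (Dom C r)" "pr0 C X \<cdot> r \<cdot> k = u" "pr1 C X \<cdot> r \<cdot> k = v"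
    using rel_mem_rep[OF assms(1,2) r] assms(3) by blast
  have "pr0 C X \<cdot> r \<cdot> (k \<cdot> g) = u \<cdot> g" "pr1 C X \<cdot> r \<cdot> (k \<cdot> g) = v \<cdot> g"
    using precomp_eq[OF k(2), of g] precomp_eq[OF k(3), of g] k(1) D assms by (auto simp: hom_def)
  then show ?thesis unfolding rel_mem_def using r k(1) assms(4)
    by (intro bexI[of _ r] bexI[of _ "k \<cdot> g"]) (auto simp: hom_def)
qed

lemma sub_le_iff:
  assumes "X \<in> Ob C" "mono_class C X R" "mono_class C X S"
  shows "sub_le C R S \<longleftrightarrow> (\<forall>u v. rel_mem C X R u v \<longrightarrow> rel_mem C X S u v)"
proof
  assume "sub_le C R S"
  then obtain m n j where mn: "m \<in> R" "n \<in> S" and j: "j \<in> hom C (Dom C m) (Dom C n)" "n \<cdot> j = m"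
    by (auto simp: sub_le_def)
  have "rel_mem C X S (pr0 C X \<cdot> m) (pr1 C X \<cdot> m)"
    unfolding rel_mem_def using mn j by (auto simp: hom_def)
  then show "\<forall>u v. rel_mem C X R u v \<longrightarrow> rel_mem C X S u v"
    unfolding rel_mem_rep[OF assms(1,2) mn(1)]
    using rel_mem_subst[OF assms(1,3)] mono_classD[OF assms(2) mn(1)] assms(1)
    by (fastforce simp: hom_def)
next
  assume *: "\<forall>u v. rel_mem C X R u v \<longrightarrow> rel_mem C X S u v"
  obtain m n where mn: "m \<in> R" "n \<in> S" using assms by (auto simp: mono_class_def)
  have "factors C m n"
    by (rule factors_if_mem[OF assms(1,3) mn(2)])
      (use mono_classD[OF assms(2) mn(1)] * rel_mem_self[OF assms(1,2) mn(1)] in auto)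
  then show "sub_le C R S" using mn by (auto simp: factors_def sub_le_def)
qed

lemma relations_eqI:
  assumes "X \<in> Ob C" "R \<in> relations C X" "S \<in> relations C X"
    and mem: "\<And>u v. rel_mem C X R u v \<longleftrightarrow> rel_mem C X S u v"
  shows "R = S"
proof -
  have *: "R \<subseteq> S" if RS: "R \<in> relations C X" "S \<in> relations C X"
    and mem: "\<And>u v. rel_mem C X R u v \<longleftrightarrow> rel_mem C X S u v" for R S
  proof
    fix n assume n: "n \<in> R"
    note R = relations_mono_class[OF RS(1)] and S = relations_mono_class[OF RS(2)]
    obtain m where m: "m \<in> S" using S by (auto simp: mono_class_def)
    note N = mono_classD[OF R n] and M = mono_classD[OF S m]
    have "factors C n m"
      by (rule factors_if_mem[OF assms(1) S m])
        (use N rel_mem_self[OF assms(1) R n] mem in auto)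
    moreover have "factors C m n"
      by (rule factors_if_mem[OF assms(1) R n])
        (use M rel_mem_self[OF assms(1) S m] mem in auto)
    ultimately show "n \<in> S" using relations_closed[OF RS(2) m] N by blast
  qed
  show ?thesis using *[of R S] *[of S R] assms by blast
qed

text \<open>Membership is local for the regular topology: the factorization of \<open>(u e, v e)\<close> through a
  representative extends along \<open>e\<close> by orthogonality.\<close>

lemma rel_mem_descent:
  assumes "X \<in> Ob C" "mono_class C X R" "regular_epi C e" "e \<in> hom C B A"
    and "u \<in> hom C A X" "v \<in> hom C A X" "rel_mem C X R (u \<cdot> e) (v \<cdot> e)"
  shows "rel_mem C X R u v"
proof -
  obtain r where r: "r \<in> R" using assms(2) by (auto simp: mono_class_def)
  note D = mono_classD[OF assms(2) r]
  have "Dom C (u \<cdot> e) = B" using assms by (auto simp: hom_def)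
  then obtain k where k: "k \<in> hom C B (Dom C r)" "pr0 C X \<cdot> r \<cdot> k = u \<cdot> e" "pr1 C X \<cdot> r \<cdot> k = v \<cdot> e"
    using rel_mem_rep[OF assms(1,2) r] assms(7) by metis
  note P = pairing_simps[OF assms(1,5,6)]
  have "pr0 C X \<cdot> (pairing C X u v \<cdot> e) = u \<cdot> e" "pr1 C X \<cdot> (pairing C X u v \<cdot> e) = v \<cdot> e"
    using precomp_eq[OF P(2), of e] precomp_eq[OF P(3), of e] P(1) assms by (auto simp: hom_def)
  then have "pr0 C X \<cdot> (r \<cdot> k) = pr0 C X \<cdot> (pairing C X u v \<cdot> e)"
    "pr1 C X \<cdot> (r \<cdot> k) = pr1 C X \<cdot> (pairing C X u v \<cdot> e)"
    using k by simp_all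
  then have "r \<cdot> k = pairing C X u v \<cdot> e"
    by (rule sq_ext[OF assms(1), of _ B, rotated 2])
      (use k(1) D P(1) assms(4) in \<open>auto simp: hom_def\<close>)
  then obtain l where l: "l \<in> hom C A (Dom C r)" "r \<cdot> l = pairing C X u v"
    using regular_epi_diagonal[OF assms(3) D(1)] assms(4) k(1) P(1) D(3) by metis
  then show ?thesis
    unfolding rel_mem_def using r P by (intro bexI[of _ r] bexI[of _ l]) (auto simp: hom_def)
qed


end

section \<open>Composite, opposite and inverse image relations\<close>

context category
begin

lemma precomp_eq3:
  assumes "h \<cdot> g \<cdot> f = d" "f \<in> Ar C" "g \<in> Ar C" "h \<in> Ar C" "k \<in> Ar C"
    "Cod C f = Dom C g" "Cod C g = Dom C h" "Cod C k = Dom C f"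
  shows "h \<cdot> g \<cdot> f \<cdot> k = d \<cdot> k"
  using assms precomp_eq[of h "g \<cdot> f" d k] by simp

end

context regular_category
begin

lemma mono_class_singleton:
  assumes "monic C m" "Cod C m = sq C X" shows "mono_class C X {m}"
  using assms factors_refl[of m] by (auto simp: mono_class_def monic_def)

text \<open>If all members of a set of monomorphisms have the same generalized elements, they factor
  through each other. Composites, opposites and inverse images are defined over all choices of
  representatives, pullbacks and factorizations, and this lemma shows the choices to be
  immaterial once the elements are computed.\<close>

lemma mono_classI:
  assumes "X \<in> Ob C" "R \<noteq> {}" "\<And>m. m \<in> R \<Longrightarrow> monic C m \<and> Cod C m = sq C X"
    and mem: "\<And>m u v. m \<in> R \<Longrightarrow> rel_mem C X {m} u v \<longleftrightarrow> P u v"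
  shows "mono_class C X R" "rel_mem C X R u v \<longleftrightarrow> P u v"
proof -
  have "factors C n m" if mn: "m \<in> R" "n \<in> R" for m n
  proof -
    have "rel_mem C X {n} (pr0 C X \<cdot> n) (pr1 C X \<cdot> n)"
      using rel_mem_self[OF assms(1) mono_class_singleton] assms(3) mn by blast
    then have "rel_mem C X {m} (pr0 C X \<cdot> n) (pr1 C X \<cdot> n)" using mem mn by blast
    then show ?thesis
      using factors_if_mem[OF assms(1) mono_class_singleton, of m m n] assms(3) mn
      by (auto simp: monic_def)
  qed
  then show "mono_class C X R" using assms(2,3) unfolding mono_class_def by blast
  show "rel_mem C X R u v \<longleftrightarrow> P u v"
  proof
    assume "rel_mem C X R u v"
    then obtain m where "m \<in> R" "rel_mem C X {m} u v" by (auto simp: rel_mem_def)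
    then show "P u v" using mem by blast
  next
    assume P: "P u v"
    obtain m where "m \<in> R" using assms(2) by blast
    then show "rel_mem C X R u v" using mem P by (fastforce simp: rel_mem_def)
  qed
qed

text \<open>The existential quantifier over the middle element is interpreted locally, that is, after
  passing to a cover of the stage \<open>Dom C u\<close> by a regular epimorphism.\<close>

definition comp_mem :: "'a \<Rightarrow> 'b set \<Rightarrow> 'b set \<Rightarrow> 'b \<Rightarrow> 'b \<Rightarrow> bool" where
  "comp_mem X S R u v \<longleftrightarrow> u \<in> hom C (Dom C u) X \<and> v \<in> hom C (Dom C u) X \<and>
     (\<exists>B e w. regular_epi C e \<and> e \<in> hom C B (Dom C u) \<and>
        rel_mem C X R (u \<cdot> e) w \<and> rel_mem C X S w (v \<cdot> e))"

text \<open>An element of the image \<open>m\<close> is covered, by pulling back the regular epimorphism of the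
  factorization, by an element of the pullback \<open>R \<times>\<^sub>X S\<close>, which carries a middle element.
  Conversely a middle element over a cover gives an arrow to that pullback, hence membership over
  the cover, and membership descends.\<close>

lemma rel_comp_mem_rep:
  assumes X: "X \<in> Ob C" and R: "mono_class C X R" and S: "mono_class C X S"
    and m: "m \<in> rel_comp C X S R"
  shows "rel_mem C X {m} u v \<longleftrightarrow> comp_mem X S R u v"
proof -
  obtain r s p q e where r: "r \<in> R" and s: "s \<in> S"
    and pb: "is_pullback C (pr1 C X \<cdot> r) (pr0 C X \<cdot> s) p q"
    and e: "regular_epi C e" "e \<in> hom C (Dom C p) (Dom C m)"
    and me: "m \<cdot> e = pairing C X (pr0 C X \<cdot> r \<cdot> p) (pr1 C X \<cdot> s \<cdot> q)"
    and mm: "monic C m" "Cod C m = sq C X"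
    using m by (auto simp: rel_comp_def)
  note M = mono_class_singleton[OF mm]
  note ar = mono_classD[OF R r] mono_classD[OF S s] mono_classD[OF M singletonI] pr_simps[OF X]
  have pq: "p \<in> Ar C" "q \<in> Ar C" "Dom C q = Dom C p" "Cod C p = Dom C r" "Cod C q = Dom C s"
    "pr1 C X \<cdot> r \<cdot> p = pr0 C X \<cdot> s \<cdot> q"
    using pb ar by (auto simp: is_pullback_def hom_def)
  have e': "e \<in> Ar C" "Dom C e = Dom C p" "Cod C e = Dom C m" using e by (auto simp: hom_def)
  have hp: "pr0 C X \<cdot> r \<cdot> p \<in> hom C (Dom C p) X" "pr1 C X \<cdot> s \<cdot> q \<in> hom C (Dom C p) X"
    using pq ar by (auto simp: hom_def)
  note mp = pairing_simps[OF X hp, folded me]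
  show ?thesis
  proof
    assume L: "rel_mem C X {m} u v"
    note uv = rel_mem_hom[OF X M L]
    obtain k where k: "k \<in> hom C (Dom C u) (Dom C m)" "pr0 C X \<cdot> m \<cdot> k = u" "pr1 C X \<cdot> m \<cdot> k = v"
      using L rel_mem_rep[OF X M singletonI] by blast
    obtain B d l where d: "regular_epi C d" "d \<in> hom C B (Dom C u)" "l \<in> hom C B (Dom C e)"
      "e \<cdot> l = k \<cdot> d"
      using regular_epi_pullback[OF e(1)] k(1) e'(3) by metis
    have kd: "k \<in> Ar C" "Cod C k = Dom C m" "d \<in> Ar C" "l \<in> Ar C" "Cod C d = Dom C k"
      "Cod C l = Dom C p" "Dom C l = Dom C d"
      using k d e' by (auto simp: hom_def)
    have 1: "pr0 C X \<cdot> r \<cdot> p \<cdot> l = u \<cdot> d"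
    proof -
      have "pr0 C X \<cdot> m \<cdot> e \<cdot> l = (pr0 C X \<cdot> r \<cdot> p) \<cdot> l"
        by (rule precomp_eq3[OF mp(2)]) (use ar e' kd in auto)
      moreover have "pr0 C X \<cdot> m \<cdot> k \<cdot> d = u \<cdot> d"
        by (rule precomp_eq3[OF k(2)]) (use ar e' kd in auto)
      ultimately show ?thesis using d(4) ar pq kd by simp
    qed
    have 2: "pr1 C X \<cdot> s \<cdot> q \<cdot> l = v \<cdot> d"
    proof -
      have "pr1 C X \<cdot> m \<cdot> e \<cdot> l = (pr1 C X \<cdot> s \<cdot> q) \<cdot> l"
        by (rule precomp_eq3[OF mp(3)]) (use ar e' kd in auto)
      moreover have "pr1 C X \<cdot> m \<cdot> k \<cdot> d = v \<cdot> d"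
        by (rule precomp_eq3[OF k(3)]) (use ar e' kd in auto)
      ultimately show ?thesis using d(4) ar pq kd by simp
    qed
    have 3: "pr1 C X \<cdot> r \<cdot> p \<cdot> l = pr0 C X \<cdot> s \<cdot> q \<cdot> l"
    proof -
      have "pr1 C X \<cdot> r \<cdot> p \<cdot> l = (pr0 C X \<cdot> s \<cdot> q) \<cdot> l"
        by (rule precomp_eq3[OF pq(6)]) (use ar kd pq in auto)
      then show ?thesis using ar pq kd by simp
    qed
    \<comment> \<open>The common value in the equation above is the middle element.\<close>
    have "rel_mem C X R (u \<cdot> d) (pr1 C X \<cdot> r \<cdot> p \<cdot> l)"
      unfolding rel_mem_def using 1 r pq kd
      by (intro bexI[of _ r] bexI[of _ "p \<cdot> l"]) auto
    moreover have "rel_mem C X S (pr1 C X \<cdot> r \<cdot> p \<cdot> l) (v \<cdot> d)"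
      unfolding rel_mem_def using 2 3 s pq kd
      by (intro bexI[of _ s] bexI[of _ "q \<cdot> l"]) auto
    ultimately show "comp_mem X S R u v"
      unfolding comp_mem_def using uv d(1,2) by blast
  next
    assume "comp_mem X S R u v"
    then obtain B d w where uv: "u \<in> hom C (Dom C u) X" "v \<in> hom C (Dom C u) X"
      and d: "regular_epi C d" "d \<in> hom C B (Dom C u)"
      and RS: "rel_mem C X R (u \<cdot> d) w" "rel_mem C X S w (v \<cdot> d)"
      unfolding comp_mem_def by blast
    have Bd: "Dom C (u \<cdot> d) = B" using uv d by (auto simp: hom_def)
    then have Bw: "Dom C w = B" using rel_mem_hom[OF X R RS(1)] by (simp add: hom_def)
    obtain a where a: "a \<in> hom C B (Dom C r)" "pr0 C X \<cdot> r \<cdot> a = u \<cdot> d" "pr1 C X \<cdot> r \<cdot> a = w"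
      using RS(1) rel_mem_rep[OF X R r] Bd by metis
    obtain b where b: "b \<in> hom C B (Dom C s)" "pr0 C X \<cdot> s \<cdot> b = w" "pr1 C X \<cdot> s \<cdot> b = v \<cdot> d"
      using RS(2) rel_mem_rep[OF X S s] Bw by metis
    have "a \<in> hom C B (Dom C (pr1 C X \<cdot> r))" "b \<in> hom C B (Dom C (pr0 C X \<cdot> s))"
      "(pr1 C X \<cdot> r) \<cdot> a = (pr0 C X \<cdot> s) \<cdot> b"
      using a b ar by (auto simp: hom_def)
    then have "\<exists>!c. c \<in> hom C B (Dom C p) \<and> p \<cdot> c = a \<and> q \<cdot> c = b"
      using pb unfolding is_pullback_def by blast
    then obtain c where c: "c \<in> hom C B (Dom C p)" "p \<cdot> c = a" "q \<cdot> c = b" by blast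
    have c': "c \<in> Ar C" "Cod C c = Dom C p" using c by (auto simp: hom_def)
    have "pr0 C X \<cdot> m \<cdot> e \<cdot> c = (pr0 C X \<cdot> r \<cdot> p) \<cdot> c"
      by (rule precomp_eq3[OF mp(2)]) (use ar e' c' in auto)
    then have 1: "pr0 C X \<cdot> m \<cdot> e \<cdot> c = u \<cdot> d" using a(2) c ar pq c' by simp
    have "pr1 C X \<cdot> m \<cdot> e \<cdot> c = (pr1 C X \<cdot> s \<cdot> q) \<cdot> c"
      by (rule precomp_eq3[OF mp(3)]) (use ar e' c' in auto)
    then have 2: "pr1 C X \<cdot> m \<cdot> e \<cdot> c = v \<cdot> d" using b(3) c ar pq c' by simp
    have "rel_mem C X {m} (u \<cdot> d) (v \<cdot> d)"
      unfolding rel_mem_def using 1 2 e' c'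
      by (intro bexI[of _ m] bexI[of _ "e \<cdot> c"]) auto
    then show "rel_mem C X {m} u v"
      by (rule rel_mem_descent[OF X M d uv])
  qed
qed

lemma rel_comp_nonempty:
  assumes X: "X \<in> Ob C" and R: "mono_class C X R" and S: "mono_class C X S"
  shows "rel_comp C X S R \<noteq> {}"
proof -
  obtain r s where r: "r \<in> R" and s: "s \<in> S" using R S by (auto simp: mono_class_def)
  note ar = mono_classD[OF R r] mono_classD[OF S s] pr_simps[OF X]
  obtain p q where pb: "is_pullback C (pr1 C X \<cdot> r) (pr0 C X \<cdot> s) p q"
    using ex_pullback[of "pr1 C X \<cdot> r" "pr0 C X \<cdot> s"] ar by auto
  have "pr0 C X \<cdot> r \<cdot> p \<in> hom C (Dom C p) X" "pr1 C X \<cdot> s \<cdot> q \<in> hom C (Dom C p) X"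
    using pb ar by (auto simp: is_pullback_def hom_def)
  then have "pairing C X (pr0 C X \<cdot> r \<cdot> p) (pr1 C X \<cdot> s \<cdot> q) \<in> hom C (Dom C p) (sq C X)"
    by (rule pairing_simps[OF X])
  then obtain m e where "monic C m" "regular_epi C e" "e \<in> hom C (Dom C p) (Dom C m)"
    "Cod C m = sq C X" "m \<cdot> e = pairing C X (pr0 C X \<cdot> r \<cdot> p) (pr1 C X \<cdot> s \<cdot> q)"
    by (rule image_factorization)
  then have "m \<in> rel_comp C X S R" unfolding rel_comp_def using r s pb by blast
  then show ?thesis by blast
qed

lemma rel_comp_mono_class:
  assumes "X \<in> Ob C" "mono_class C X R" "mono_class C X S"
  shows "mono_class C X (rel_comp C X S R)"
    "rel_mem C X (rel_comp C X S R) u v \<longleftrightarrow> comp_mem X S R u v"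
proof -
  have "monic C m \<and> Cod C m = sq C X" if "m \<in> rel_comp C X S R" for m
    using that by (simp add: rel_comp_def)
  note mono_classI[OF assms(1) rel_comp_nonempty[OF assms] this rel_comp_mem_rep[OF assms]]
  then show "mono_class C X (rel_comp C X S R)"
    "rel_mem C X (rel_comp C X S R) u v \<longleftrightarrow> comp_mem X S R u v" by blast+
qed

lemma rel_comp_relation:
  assumes "X \<in> Ob C" "mono_class C X R" "mono_class C X S"
  shows "rel_comp C X S R \<in> relations C X"
proof (rule relationsI[OF rel_comp_mono_class(1)[OF assms]])
  fix m n i assume m: "m \<in> rel_comp C X S R" and n: "monic C n" "Cod C n = sq C X"
    and i: "is_iso C i" "i \<in> hom C (Dom C m) (Dom C n)" "n \<cdot> i = m"
  obtain r s p q e where rs: "r \<in> R" "s \<in> S"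
    "is_pullback C (pr1 C X \<cdot> r) (pr0 C X \<cdot> s) p q"
    and e: "regular_epi C e" "e \<in> hom C (Dom C p) (Dom C m)"
    and me: "m \<cdot> e = pairing C X (pr0 C X \<cdot> r \<cdot> p) (pr1 C X \<cdot> s \<cdot> q)"
    using m by (auto simp: rel_comp_def)
  have "regular_epi C (i \<cdot> e)" "i \<cdot> e \<in> hom C (Dom C p) (Dom C n)"
    using iso_comp_regular_epi[OF e(1) i(1)] e i by (auto simp: hom_def)
  moreover have "n \<cdot> (i \<cdot> e) = m \<cdot> e"
    by (rule precomp_eq[OF i(3)]) (use i e n in \<open>auto simp: hom_def monic_def\<close>)
  ultimately show "n \<in> rel_comp C X S R"
    unfolding rel_comp_def mem_Collect_eq me using n rs by blast
qed

lemma swap_simps: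
  assumes "X \<in> Ob C" "m \<in> hom C A (sq C X)"
  shows "pairing C X (pr1 C X \<cdot> m) (pr0 C X \<cdot> m) \<in> hom C A (sq C X)"
    "pr0 C X \<cdot> pairing C X (pr1 C X \<cdot> m) (pr0 C X \<cdot> m) = pr1 C X \<cdot> m"
    "pr1 C X \<cdot> pairing C X (pr1 C X \<cdot> m) (pr0 C X \<cdot> m) = pr0 C X \<cdot> m"
proof -
  have "pr1 C X \<cdot> m \<in> hom C A X" "pr0 C X \<cdot> m \<in> hom C A X"
    using assms by (auto simp: hom_def)
  note pairing_simps[OF assms(1) this]
  then show "pairing C X (pr1 C X \<cdot> m) (pr0 C X \<cdot> m) \<in> hom C A (sq C X)"
    "pr0 C X \<cdot> pairing C X (pr1 C X \<cdot> m) (pr0 C X \<cdot> m) = pr1 C X \<cdot> m"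
    "pr1 C X \<cdot> pairing C X (pr1 C X \<cdot> m) (pr0 C X \<cdot> m) = pr0 C X \<cdot> m" by auto
qed

lemma swap_precomp:
  assumes "X \<in> Ob C" "m \<in> hom C A (sq C X)" "k \<in> hom C B A"
  shows "pr0 C X \<cdot> pairing C X (pr1 C X \<cdot> m) (pr0 C X \<cdot> m) \<cdot> k = pr1 C X \<cdot> m \<cdot> k"
    "pr1 C X \<cdot> pairing C X (pr1 C X \<cdot> m) (pr0 C X \<cdot> m) \<cdot> k = pr0 C X \<cdot> m \<cdot> k"
  using precomp_eq[OF swap_simps(2)[OF assms(1,2)], of k]
    precomp_eq[OF swap_simps(3)[OF assms(1,2)], of k] swap_simps(1)[OF assms(1,2)] assms
  by (auto simp: hom_def)

text \<open>Exchanging the two components is injective on generalized elements.\<close>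

lemma monic_swap:
  assumes X: "X \<in> Ob C" and m: "monic C m" "Cod C m = sq C X"
  shows "monic C (pairing C X (pr1 C X \<cdot> m) (pr0 C X \<cdot> m))" (is "monic C ?t")
proof -
  have mh: "m \<in> hom C (Dom C m) (sq C X)" using m by (auto simp: monic_def hom_def)
  note t = swap_simps[OF X mh]
  have Dt: "?t \<in> Ar C" "Dom C ?t = Dom C m" using t(1) by (auto simp: hom_def)
  show ?thesis
    unfolding monic_def
  proof (intro conjI allI ballI impI)
    fix a u v assume uv: "u \<in> hom C a (Dom C ?t)" "v \<in> hom C a (Dom C ?t)" "?t \<cdot> u = ?t \<cdot> v"
    have uv': "u \<in> hom C a (Dom C m)" "v \<in> hom C a (Dom C m)" using uv Dt by auto
    have "m \<cdot> u = m \<cdot> v"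
      by (rule sq_ext[OF X, of _ a])
        (use uv(3) swap_precomp[OF X mh uv'(1)] swap_precomp[OF X mh uv'(2)] uv' mh in
          \<open>auto simp: hom_def\<close>)
    then show "u = v" by (rule monic_cancel[OF m(1) _ uv'])
  qed (rule Dt)
qed

lemma rel_op_mono_class:
  assumes X: "X \<in> Ob C" and R: "mono_class C X R"
  shows "mono_class C X (rel_op C X R)" "rel_mem C X (rel_op C X R) u v \<longleftrightarrow> rel_mem C X R v u"
proof -
  have 1: "rel_op C X R \<noteq> {}" using R by (auto simp: rel_op_def mono_class_def)
  have 2: "monic C m \<and> Cod C m = sq C X" if m: "m \<in> rel_op C X R" for m
  proof -
    obtain r where r: "r \<in> R" "m = pairing C X (pr1 C X \<cdot> r) (pr0 C X \<cdot> r)"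
      using m by (auto simp: rel_op_def)
    have "r \<in> hom C (Dom C r) (sq C X)" using mono_classD[OF R r(1)] by (simp add: hom_def)
    then show ?thesis
      using r(2) monic_swap[OF X] swap_simps(1)[OF X] mono_classD[OF R r(1)]
      by (auto simp: hom_def)
  qed
  have 3: "rel_mem C X {m} u v \<longleftrightarrow> rel_mem C X R v u" if m: "m \<in> rel_op C X R" for m u v
  proof -
    obtain r where r: "r \<in> R" "m = pairing C X (pr1 C X \<cdot> r) (pr0 C X \<cdot> r)"
      using m by (auto simp: rel_op_def)
    have rh: "r \<in> hom C (Dom C r) (sq C X)" using mono_classD[OF R r(1)] by (simp add: hom_def)
    have Dm: "Dom C m = Dom C r" using swap_simps(1)[OF X rh] r(2) by (simp add: hom_def)
    note sw = swap_precomp[OF X rh, folded r(2)]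
    note M = mono_class_singleton[of m X]
    show ?thesis
    proof
      assume L: "rel_mem C X {m} u v"
      then obtain k where k: "k \<in> hom C (Dom C u) (Dom C r)" "pr0 C X \<cdot> m \<cdot> k = u" "pr1 C X \<cdot> m \<cdot> k = v"
        using rel_mem_rep[OF X M singletonI] 2[OF m] Dm by auto
      then show "rel_mem C X R v u"
        unfolding rel_mem_def using r(1) sw[OF k(1)]
        by (intro bexI[of _ r] bexI[of _ k]) (auto simp: hom_def)
    next
      assume "rel_mem C X R v u"
      then obtain k where k: "k \<in> hom C (Dom C v) (Dom C r)" "pr0 C X \<cdot> r \<cdot> k = v" "pr1 C X \<cdot> r \<cdot> k = u"
        using rel_mem_rep[OF X R r(1)] by auto
      then show "rel_mem C X {m} u v"
        unfolding rel_mem_def using sw[OF k(1)] Dm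
        by (intro bexI[of _ m] bexI[of _ k]) (auto simp: hom_def)
    qed
  qed
  show "mono_class C X (rel_op C X R)" "rel_mem C X (rel_op C X R) u v \<longleftrightarrow> rel_mem C X R v u"
    using mono_classI[OF X 1 2, of "\<lambda>u v. rel_mem C X R v u"] 3 by auto
qed

text \<open>As the exchange of components is an involution, closure of \<open>R\<close> under isomorphism passes to
  the opposite: a monomorphism isomorphic to the exchange of \<open>r\<close> is the exchange of a monomorphism
  isomorphic to \<open>r\<close>.\<close>

lemma rel_op_relation:
  assumes X: "X \<in> Ob C" and R: "R \<in> relations C X"
  shows "rel_op C X R \<in> relations C X"
proof (rule relationsI[OF rel_op_mono_class(1)[OF X relations_mono_class[OF R]]])
  let ?t = "\<lambda>m. pairing C X (pr1 C X \<cdot> m) (pr0 C X \<cdot> m)"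
  fix m n i assume m: "m \<in> rel_op C X R" and n: "monic C n" "Cod C n = sq C X"
    and i: "is_iso C i" "i \<in> hom C (Dom C m) (Dom C n)" "n \<cdot> i = m"
  obtain r where r: "r \<in> R" "m = ?t r" using m by (auto simp: rel_op_def)
  note Rc = relations_mono_class[OF R]
  have rh: "r \<in> hom C (Dom C r) (sq C X)" using mono_classD[OF Rc r(1)] by (simp add: hom_def)
  have nh: "n \<in> hom C (Dom C n) (sq C X)" using n by (auto simp: monic_def hom_def)
  note rt = swap_simps[OF X rh, folded r(2)] and nt = swap_simps[OF X nh]
  have Dm: "Dom C m = Dom C r" using rt(1) by (auto simp: hom_def)
  have tn: "?t n \<cdot> i = r"
    by (rule sq_ext[OF X, of _ "Dom C m"])
      (use swap_precomp[OF X nh i(2)] i(3) rt rh Dm i(2) nt(1) in \<open>auto simp: hom_def\<close>)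
  obtain j where j: "j \<in> hom C (Dom C n) (Dom C m)" "i \<cdot> j = Idn C (Dom C n)"
    using i by (auto simp: is_iso_def hom_def)
  have "?t n \<cdot> (i \<cdot> j) = r \<cdot> j"
    by (rule precomp_eq[OF tn]) (use i j nt(1) in \<open>auto simp: hom_def\<close>)
  then have rj: "r \<cdot> j = ?t n" using j nt(1) by (auto simp: hom_def)
  have "?t n \<in> R"
  proof (rule relations_closed[OF R r(1) monic_swap[OF X n]])
    show "Cod C (?t n) = sq C X" using nt(1) by (simp add: hom_def)
    show "factors C r (?t n)" "factors C (?t n) r"
      unfolding factors_def using tn rj i(2) j(1) nt(1) Dm by (auto simp: hom_def)
  qed
  moreover have "?t (?t n) = n"
    by (rule sq_ext[OF X swap_simps(1)[OF X nt(1)] nh])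
      (use swap_simps[OF X nt(1)] nt in auto)
  ultimately show "n \<in> rel_op C X R" unfolding rel_op_def by force
qed

lemma sq_map_simps:
  assumes "X \<in> Ob C" "Y \<in> Ob C" "f \<in> hom C X Y"
  shows "sq_map C f \<in> hom C (sq C X) (sq C Y)"
    "pr0 C Y \<cdot> sq_map C f = f \<cdot> pr0 C X" "pr1 C Y \<cdot> sq_map C f = f \<cdot> pr1 C X"
proof -
  have f: "Dom C f = X" "Cod C f = Y" using assms by (auto simp: hom_def)
  have "f \<cdot> pr0 C X \<in> hom C (sq C X) Y" "f \<cdot> pr1 C X \<in> hom C (sq C X) Y"
    using assms by (auto simp: hom_def)
  from pairing_simps[OF assms(2) this]
  show "sq_map C f \<in> hom C (sq C X) (sq C Y)"
    "pr0 C Y \<cdot> sq_map C f = f \<cdot> pr0 C X" "pr1 C Y \<cdot> sq_map C f = f \<cdot> pr1 C X"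
    by (auto simp: sq_map_def f)
qed

lemma sq_map_precomp:
  assumes "X \<in> Ob C" "Y \<in> Ob C" "f \<in> hom C X Y" "m \<in> hom C A (sq C X)"
  shows "pr0 C Y \<cdot> sq_map C f \<cdot> m = f \<cdot> pr0 C X \<cdot> m" "pr1 C Y \<cdot> sq_map C f \<cdot> m = f \<cdot> pr1 C X \<cdot> m"
  using precomp_eq[OF sq_map_simps(2)[OF assms(1-3)], of m]
    precomp_eq[OF sq_map_simps(3)[OF assms(1-3)], of m] sq_map_simps(1)[OF assms(1-3)] assms
  by (auto simp: hom_def)

text \<open>Both claims are the universal property of the pullback along \<open>f \<times> f\<close>, read on the pair
  \<open>(u, v)\<close>.\<close>

lemma rel_inv_image_mono_class:
  assumes X: "X \<in> Ob C" and Y: "Y \<in> Ob C" and f: "f \<in> hom C X Y" and S: "mono_class C Y S"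
  shows "mono_class C X (rel_inv_image C f S)"
    "rel_mem C X (rel_inv_image C f S) u v \<longleftrightarrow>
      u \<in> hom C (Dom C u) X \<and> v \<in> hom C (Dom C u) X \<and> rel_mem C Y S (f \<cdot> u) (f \<cdot> v)"
proof -
  let ?P = "\<lambda>u v. u \<in> hom C (Dom C u) X \<and> v \<in> hom C (Dom C u) X \<and> rel_mem C Y S (f \<cdot> u) (f \<cdot> v)"
  let ?F = "sq_map C f"
  note F = sq_map_simps(1)[OF X Y f]
  have F': "?F \<in> Ar C" "Dom C ?F = sq C X" "Cod C ?F = sq C Y" using F by (auto simp: hom_def)
  have f': "f \<in> Ar C" "Dom C f = X" "Cod C f = Y" using f by (auto simp: hom_def)
  have 1: "rel_inv_image C f S \<noteq> {}"
  proof -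
    obtain s where s: "s \<in> S" using S by (auto simp: mono_class_def)
    obtain p q where "is_pullback C ?F s p q"
      using ex_pullback[of ?F s] F' mono_classD[OF S s] by auto
    then show ?thesis using s by (auto simp: rel_inv_image_def)
  qed
  have 2: "monic C m \<and> Cod C m = sq C X" if m: "m \<in> rel_inv_image C f S" for m
  proof -
    obtain s q where s: "s \<in> S" and pb: "is_pullback C ?F s m q"
      using m by (auto simp: rel_inv_image_def)
    note sD = mono_classD[OF S s]
    have mq: "m \<in> Ar C" "Cod C m = sq C X" "q \<in> Ar C" "Dom C q = Dom C m" "Cod C q = Dom C s"
      "?F \<cdot> m = s \<cdot> q"
      using pb F' by (auto simp: is_pullback_def hom_def)
    have "u = v" if uv: "u \<in> hom C a (Dom C m)" "v \<in> hom C a (Dom C m)" "m \<cdot> u = m \<cdot> v" for a u v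
    proof -
      have uv': "u \<in> Ar C" "Dom C u = a" "Cod C u = Dom C m" "v \<in> Ar C" "Dom C v = a" "Cod C v = Dom C m"
        using uv by (auto simp: hom_def)
      have Fu: "?F \<cdot> (m \<cdot> u) = s \<cdot> q \<cdot> u" "?F \<cdot> (m \<cdot> v) = s \<cdot> q \<cdot> v"
        using precomp_eq[OF mq(6), of u] precomp_eq[OF mq(6), of v] mq uv' F' sD by auto
      then have "s \<cdot> (q \<cdot> u) = s \<cdot> (q \<cdot> v)" using uv(3) by simp
      then have qq: "q \<cdot> u = q \<cdot> v"
        by (rule monic_cancel[OF sD(1), of _ _ a]) (use mq uv' in \<open>auto simp: hom_def\<close>)
      have "m \<cdot> u \<in> hom C a (Dom C ?F)" "q \<cdot> u \<in> hom C a (Dom C s)"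
        using mq uv' F' by (auto simp: hom_def)
      then have "\<exists>!w. w \<in> hom C a (Dom C m) \<and> m \<cdot> w = m \<cdot> u \<and> q \<cdot> w = q \<cdot> u"
        using pb Fu(1) unfolding is_pullback_def by blast
      then show "u = v" using uv qq by metis
    qed
    then show ?thesis using mq by (auto simp: monic_def)
  qed
  have 3: "rel_mem C X {m} u v \<longleftrightarrow> ?P u v" if m: "m \<in> rel_inv_image C f S" for m u v
  proof -
    obtain s q where s: "s \<in> S" and pb: "is_pullback C ?F s m q"
      using m by (auto simp: rel_inv_image_def)
    note sD = mono_classD[OF S s]
    have mq: "m \<in> Ar C" "Cod C m = sq C X" "q \<in> Ar C" "Dom C q = Dom C m" "Cod C q = Dom C s"
      "?F \<cdot> m = s \<cdot> q"
      using pb F' by (auto simp: is_pullback_def hom_def)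
    have M: "mono_class C X {m}" using 2[OF m] mono_class_singleton by blast
    show ?thesis
    proof
      assume L: "rel_mem C X {m} u v"
      then obtain k where k: "k \<in> hom C (Dom C u) (Dom C m)" "pr0 C X \<cdot> m \<cdot> k = u" "pr1 C X \<cdot> m \<cdot> k = v"
        using rel_mem_rep[OF X M singletonI] by auto
      have k': "k \<in> Ar C" "Cod C k = Dom C m" using k by (auto simp: hom_def)
      have "?F \<cdot> m \<cdot> k = (s \<cdot> q) \<cdot> k"
        by (rule precomp_eq[OF mq(6)]) (use mq F' k' in auto)
      then have Fk: "s \<cdot> q \<cdot> k = ?F \<cdot> m \<cdot> k" using sD mq k' by simp
      have mk: "m \<cdot> k \<in> hom C (Dom C k) (sq C X)" using mq k' by (auto simp: hom_def)
      have "rel_mem C Y S (f \<cdot> u) (f \<cdot> v)"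
        unfolding rel_mem_def using s Fk sq_map_precomp[OF X Y f mk] k mq k'
        by (intro bexI[of _ s] bexI[of _ "q \<cdot> k"]) auto
      then show "?P u v" using rel_mem_hom[OF X M L] by blast
    next
      assume P: "?P u v"
      then have uv: "u \<in> hom C (Dom C u) X" "v \<in> hom C (Dom C u) X" by auto
      note w = pairing_simps[OF X uv]
      let ?w = "pairing C X u v"
      have "Dom C (f \<cdot> u) = Dom C u" using f' uv by (auto simp: hom_def)
      then obtain k where k: "k \<in> hom C (Dom C u) (Dom C s)" "pr0 C Y \<cdot> s \<cdot> k = f \<cdot> u"
        "pr1 C Y \<cdot> s \<cdot> k = f \<cdot> v"
        using P rel_mem_rep[OF Y S s] by metis
      have "?F \<cdot> ?w = s \<cdot> k"
        by (rule sq_ext[OF Y, of _ "Dom C u"])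
          (use sq_map_precomp[OF X Y f w(1)] w k sD F' in \<open>auto simp: hom_def\<close>)
      moreover have "?w \<in> hom C (Dom C u) (Dom C ?F)" using w F' by simp
      ultimately have "\<exists>!z. z \<in> hom C (Dom C u) (Dom C m) \<and> m \<cdot> z = ?w \<and> q \<cdot> z = k"
        using pb k(1) unfolding is_pullback_def by blast
      then obtain z where "z \<in> hom C (Dom C u) (Dom C m)" "m \<cdot> z = ?w" by blast
      then show "rel_mem C X {m} u v"
        unfolding rel_mem_def using w by (intro bexI[of _ m] bexI[of _ z]) (auto simp: hom_def)
    qed
  qed
  show "mono_class C X (rel_inv_image C f S)" "rel_mem C X (rel_inv_image C f S) u v \<longleftrightarrow> ?P u v"
    using mono_classI[OF X 1 2, of ?P] 3 by auto
qed

lemma rel_inv_image_relation: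
  assumes X: "X \<in> Ob C" and Y: "Y \<in> Ob C" and f: "f \<in> hom C X Y" and S: "mono_class C Y S"
  shows "rel_inv_image C f S \<in> relations C X"
proof (rule relationsI[OF rel_inv_image_mono_class(1)[OF assms]])
  fix m n i assume m: "m \<in> rel_inv_image C f S" and n: "monic C n" "Cod C n = sq C X"
    and i: "is_iso C i" "i \<in> hom C (Dom C m) (Dom C n)" "n \<cdot> i = m"
  let ?F = "sq_map C f"
  have F': "?F \<in> Ar C" "Dom C ?F = sq C X" "Cod C ?F = sq C Y"
    using sq_map_simps(1)[OF X Y f] by (auto simp: hom_def)
  obtain s q where s: "s \<in> S" and pb: "is_pullback C ?F s m q"
    using m by (auto simp: rel_inv_image_def)
  note sD = mono_classD[OF S s]
  have mq: "m \<in> Ar C" "Cod C m = sq C X" "q \<in> Ar C" "Dom C q = Dom C m" "Cod C q = Dom C s"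
    "?F \<cdot> m = s \<cdot> q"
    using pb F' by (auto simp: is_pullback_def hom_def)
  have n': "n \<in> Ar C" using n by (simp add: monic_def)
  obtain j where j: "j \<in> Ar C" "Dom C j = Dom C n" "Cod C j = Dom C m" "i \<cdot> j = Idn C (Dom C n)"
    "j \<cdot> i = Idn C (Dom C m)"
    using i by (auto simp: is_iso_def hom_def)
  have i': "i \<in> Ar C" "Dom C i = Dom C m" "Cod C i = Dom C n" using i by (auto simp: hom_def)
  have "n \<cdot> (i \<cdot> j) = m \<cdot> j"
    by (rule precomp_eq[OF i(3)]) (use n' i' j in auto)
  then have mj: "m \<cdot> j = n" using j n' by simp
  have "is_pullback C ?F s n (q \<cdot> j)"
    unfolding is_pullback_def
  proof (intro conjI allI ballI impI)
    have "?F \<cdot> (m \<cdot> j) = (s \<cdot> q) \<cdot> j"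
      by (rule precomp_eq[OF mq(6)]) (use mq j F' in auto)
    then show "?F \<cdot> n = s \<cdot> q \<cdot> j" using mj mq j sD by simp
    fix a u v assume "u \<in> hom C a (Dom C ?F)" "v \<in> hom C a (Dom C s)" "?F \<cdot> u = s \<cdot> v"
    then have "\<exists>!w. w \<in> hom C a (Dom C m) \<and> m \<cdot> w = u \<and> q \<cdot> w = v"
      using pb unfolding is_pullback_def by blast
    then obtain w where w: "w \<in> Ar C" "Dom C w = a" "Cod C w = Dom C m" "m \<cdot> w = u" "q \<cdot> w = v"
      by (auto simp: hom_def)
    have "n \<cdot> (i \<cdot> w) = m \<cdot> w" by (rule precomp_eq[OF i(3)]) (use n' i' w in auto)
    moreover have "j \<cdot> (i \<cdot> w) = Idn C (Dom C m) \<cdot> w"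
      by (rule precomp_eq[OF j(5)]) (use i' j w in auto)
    ultimately have ex: "i \<cdot> w \<in> hom C a (Dom C n) \<and> n \<cdot> (i \<cdot> w) = u \<and> (q \<cdot> j) \<cdot> (i \<cdot> w) = v"
      using w i' j mq by (auto simp: hom_def)
    show "\<exists>!z. z \<in> hom C a (Dom C n) \<and> n \<cdot> z = u \<and> (q \<cdot> j) \<cdot> z = v"
      by (rule ex1I[where a = "i \<cdot> w"], rule ex) (use ex monic_cancel[OF n(1)] in metis)
  qed (use F' sD n n' mq j in \<open>auto simp: hom_def\<close>)
  then show "n \<in> rel_inv_image C f S" using s by (auto simp: rel_inv_image_def)
qed

lemma diag_mono_class:
  assumes X: "X \<in> Ob C"
  shows "mono_class C X (diag C X)"
    "rel_mem C X (diag C X) u v \<longleftrightarrow> u \<in> hom C (Dom C u) X \<and> u = v"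
proof -
  let ?d = "pairing C X (Idn C X) (Idn C X)"
  have I: "Idn C X \<in> hom C X X" using X by (rule idn_hom)
  note d = pairing_simps[OF X I I]
  have d': "?d \<in> Ar C" "Dom C ?d = X" "Cod C ?d = sq C X" using d(1) by (auto simp: hom_def)
  have dk: "pr0 C X \<cdot> ?d \<cdot> k = k" "pr1 C X \<cdot> ?d \<cdot> k = k" if "k \<in> Ar C" "Cod C k = X" for k
    using precomp_eq[OF d(2), of k] precomp_eq[OF d(3), of k] d' X that by auto
  have m: "monic C ?d"
    unfolding monic_def
  proof (intro conjI allI ballI impI)
    fix a u v assume uv: "u \<in> hom C a (Dom C ?d)" "v \<in> hom C a (Dom C ?d)" "?d \<cdot> u = ?d \<cdot> v"
    have "pr0 C X \<cdot> ?d \<cdot> u = u" "pr0 C X \<cdot> ?d \<cdot> v = v"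
      by (rule dk(1); use uv(1,2) d'(2) in \<open>simp add: hom_def\<close>)+
    then show "u = v" using uv(3) by metis
  qed (rule d')
  note D = relation_of_mono[OF m d'(3), folded diag_def]
  show c: "mono_class C X (diag C X)" by (rule relations_mono_class[OF D(1)])
  show "rel_mem C X (diag C X) u v \<longleftrightarrow> u \<in> hom C (Dom C u) X \<and> u = v"
  proof
    assume "rel_mem C X (diag C X) u v"
    then obtain k where "k \<in> hom C (Dom C u) X" "pr0 C X \<cdot> ?d \<cdot> k = u" "pr1 C X \<cdot> ?d \<cdot> k = v"
      unfolding rel_mem_rep[OF X c D(2)] d'(2) by blast
    then show "u \<in> hom C (Dom C u) X \<and> u = v" using dk[of k] by (simp add: hom_def)
  next
    assume "u \<in> hom C (Dom C u) X \<and> u = v"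
    then show "rel_mem C X (diag C X) u v"
      unfolding rel_mem_rep[OF X c D(2)] d'(2) using dk[of u] by (auto simp: hom_def)
  qed
qed


end

section \<open>Order, reflexivity, symmetry and transitivity in terms of elements\<close>

context regular_category
begin

text \<open>A middle element that exists at the given stage is covered by the identity.\<close>

lemma comp_memI:
  assumes "X \<in> Ob C" "mono_class C X R" "mono_class C X S"
    and "rel_mem C X R u w" "rel_mem C X S w v"
  shows "comp_mem X S R u v"
proof -
  note u = rel_mem_hom[OF assms(1,2,4)] and w = rel_mem_hom[OF assms(1,3,5)]
  have "Dom C w = Dom C u" using u(2) by (simp add: hom_def)
  then have v: "v \<in> hom C (Dom C u) X" using w(2) by simp
  have "Dom C u \<in> Ob C" using u(1) dom_ob by (simp add: hom_def)
  then have "regular_epi C (Idn C (Dom C u))" "Idn C (Dom C u) \<in> hom C (Dom C u) (Dom C u)"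
    using idn_regular_epi idn_hom by auto
  moreover have "u \<cdot> Idn C (Dom C u) = u" "v \<cdot> Idn C (Dom C u) = v"
    using u v by (simp_all add: hom_def)
  ultimately show ?thesis unfolding comp_mem_def using u(1) v assms(4,5) by metis
qed

text \<open>The regular epimorphism hidden in the composite disappears because membership in \<open>T\<close> descends
  along it. Composites on the smaller side of an inclusion are therefore handled as for relations
  between sets.\<close>

lemma rel_comp_le_iff:
  assumes "X \<in> Ob C" "mono_class C X R" "mono_class C X S" "mono_class C X T"
  shows "sub_le C (rel_comp C X S R) T \<longleftrightarrow>
    (\<forall>u w v. rel_mem C X R u w \<longrightarrow> rel_mem C X S w v \<longrightarrow> rel_mem C X T u v)"
    (is "?L \<longleftrightarrow> ?R")
proof -
  have L: "?L \<longleftrightarrow> (\<forall>u v. comp_mem X S R u v \<longrightarrow> rel_mem C X T u v)"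
    unfolding sub_le_iff[OF assms(1) rel_comp_mono_class(1)[OF assms(1-3)] assms(4)]
      rel_comp_mono_class(2)[OF assms(1-3)] ..
  show ?thesis
  proof
    assume ?L
    then show ?R using L comp_memI[OF assms(1-3)] by blast
  next
    assume R: ?R
    have "rel_mem C X T u v" if c: "comp_mem X S R u v" for u v
    proof -
      obtain B e w where uv: "u \<in> hom C (Dom C u) X" "v \<in> hom C (Dom C u) X"
        and e: "regular_epi C e" "e \<in> hom C B (Dom C u)"
        and "rel_mem C X R (u \<cdot> e) w" "rel_mem C X S w (v \<cdot> e)"
        using c unfolding comp_mem_def by blast
      then have "rel_mem C X T (u \<cdot> e) (v \<cdot> e)" using R by blast
      then show ?thesis by (rule rel_mem_descent[OF assms(1,4) e uv])
    qed
    then show ?L using L by blast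
  qed
qed

lemma reflexive_rels_iff:
  assumes "X \<in> Ob C"
  shows "R \<in> reflexive_rels C X \<longleftrightarrow>
    R \<in> relations C X \<and> (\<forall>A. \<forall>u\<in>hom C A X. rel_mem C X R u u)"
proof -
  have "sub_le C (diag C X) R \<longleftrightarrow> (\<forall>A. \<forall>u\<in>hom C A X. rel_mem C X R u u)"
    if R: "R \<in> relations C X"
    unfolding sub_le_iff[OF assms diag_mono_class(1)[OF assms] relations_mono_class[OF R]]
      diag_mono_class(2)[OF assms]
    by (auto simp: hom_def)
  then show ?thesis unfolding reflexive_rels_def by blast
qed

lemma reflexive_relsD:
  assumes "X \<in> Ob C" "R \<in> reflexive_rels C X"
  shows "R \<in> relations C X" "mono_class C X R" "u \<in> hom C A X \<Longrightarrow> rel_mem C X R u u"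
  using assms reflexive_rels_iff relations_mono_class by blast+

lemma reflexive_le_iff:
  assumes "X \<in> Ob C" "R \<in> reflexive_rels C X" "S \<in> reflexive_rels C X"
  shows "sub_le C R S \<longleftrightarrow> (\<forall>u v. rel_mem C X R u v \<longrightarrow> rel_mem C X S u v)"
  using sub_le_iff reflexive_relsD assms by blast

lemma transitive_rel_iff:
  assumes "X \<in> Ob C" "mono_class C X R"
  shows "transitive_rel C X R \<longleftrightarrow>
    (\<forall>u w v. rel_mem C X R u w \<longrightarrow> rel_mem C X R w v \<longrightarrow> rel_mem C X R u v)"
  unfolding transitive_rel_def using rel_comp_le_iff assms by blast

lemma symmetric_rel_iff:
  assumes "X \<in> Ob C" "mono_class C X R"
  shows "symmetric_rel C X R \<longleftrightarrow> (\<forall>u v. rel_mem C X R u v \<longrightarrow> rel_mem C X R v u)"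
  unfolding symmetric_rel_def
    sub_le_iff[OF assms(1) rel_op_mono_class(1)[OF assms] assms(2)] rel_op_mono_class(2)[OF assms]
  by blast

lemma le_inv_image_iff:
  assumes "X \<in> Ob C" "Y \<in> Ob C" "f \<in> hom C X Y" "mono_class C X R" "mono_class C Y S"
  shows "sub_le C R (rel_inv_image C f S) \<longleftrightarrow>
    (\<forall>u v. rel_mem C X R u v \<longrightarrow> rel_mem C Y S (f \<cdot> u) (f \<cdot> v))"
  unfolding sub_le_iff[OF assms(1,4) rel_inv_image_mono_class(1)[OF assms(1-3,5)]]
    rel_inv_image_mono_class(2)[OF assms(1-3,5)]
  using rel_mem_hom[OF assms(1,4)] by blast

lemma rel_comp_reflexive:
  assumes X: "X \<in> Ob C" and R: "R \<in> reflexive_rels C X" and S: "S \<in> reflexive_rels C X"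
  shows "rel_comp C X S R \<in> reflexive_rels C X"
    "rel_mem C X R u w \<Longrightarrow> rel_mem C X S w v \<Longrightarrow> rel_mem C X (rel_comp C X S R) u v"
proof -
  note R' = reflexive_relsD[OF X R] and S' = reflexive_relsD[OF X S]
  show 1: "rel_mem C X (rel_comp C X S R) u v" if "rel_mem C X R u w" "rel_mem C X S w v" for u v w
    using comp_memI[OF X R'(2) S'(2) that] rel_comp_mono_class(2)[OF X R'(2) S'(2)] by blast
  show "rel_comp C X S R \<in> reflexive_rels C X"
    unfolding reflexive_rels_iff[OF X]
    using rel_comp_relation[OF X R'(2) S'(2)] 1 R'(3) S'(3) by blast
qed

lemma reflexive_le_rel_comp:
  assumes X: "X \<in> Ob C" and R: "R \<in> reflexive_rels C X" and S: "S \<in> reflexive_rels C X"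
  shows "sub_le C R (rel_comp C X S R)" "sub_le C S (rel_comp C X S R)"
proof -
  note R' = reflexive_relsD[OF X R] and S' = reflexive_relsD[OF X S]
  note c = rel_comp_reflexive[OF X R S]
  show "sub_le C R (rel_comp C X S R)" "sub_le C S (rel_comp C X S R)"
    unfolding reflexive_le_iff[OF X R c(1)] reflexive_le_iff[OF X S c(1)]
    using c(2) R'(3) S'(3) rel_mem_hom[OF X R'(2)] rel_mem_hom[OF X S'(2)] by blast+
qed

lemma rel_op_reflexive:
  assumes X: "X \<in> Ob C" and R: "R \<in> reflexive_rels C X"
  shows "rel_op C X R \<in> reflexive_rels C X"
    "rel_mem C X (rel_op C X R) u v \<longleftrightarrow> rel_mem C X R v u"
proof -
  note R' = reflexive_relsD[OF X R]
  show m: "rel_mem C X (rel_op C X R) u v \<longleftrightarrow> rel_mem C X R v u" for u v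
    by (rule rel_op_mono_class(2)[OF X R'(2)])
  show "rel_op C X R \<in> reflexive_rels C X"
    unfolding reflexive_rels_iff[OF X] m using rel_op_relation[OF X R'(1)] R'(3) by blast
qed

lemma rel_inv_image_reflexive:
  assumes X: "X \<in> Ob C" and Y: "Y \<in> Ob C" and f: "f \<in> hom C X Y"
    and S: "S \<in> reflexive_rels C Y"
  shows "rel_inv_image C f S \<in> reflexive_rels C X"
proof -
  note S' = reflexive_relsD[OF Y S]
  have "rel_mem C X (rel_inv_image C f S) u u" if u: "u \<in> hom C A X" for A u
  proof -
    have "f \<cdot> u \<in> hom C A Y" using u f by (rule comp_hom)
    then have "rel_mem C Y S (f \<cdot> u) (f \<cdot> u)" by (rule S'(3))
    then show ?thesis
      unfolding rel_inv_image_mono_class(2)[OF X Y f S'(2)] using u by (simp add: hom_def)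
  qed
  then show ?thesis
    unfolding reflexive_rels_iff[OF X] using rel_inv_image_relation[OF X Y f S'(2)] by blast
qed

lemma preorder_rel_inv_image:
  assumes X: "X \<in> Ob C" and Y: "Y \<in> Ob C" and f: "f \<in> hom C X Y" and S: "preorder_rel C Y S"
  shows "preorder_rel C X (rel_inv_image C f S)"
proof -
  have Sr: "S \<in> reflexive_rels C Y" using S by (simp add: preorder_rel_def)
  note S' = reflexive_relsD[OF Y Sr] and I = rel_inv_image_mono_class[OF X Y f]
  have "transitive_rel C Y S" using S by (simp add: preorder_rel_def)
  then have "transitive_rel C X (rel_inv_image C f S)"
    unfolding transitive_rel_iff[OF Y S'(2)] transitive_rel_iff[OF X I(1)[OF S'(2)]] I(2)[OF S'(2)]
    by (auto simp: hom_def)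
  then show ?thesis using rel_inv_image_reflexive[OF X Y f Sr] by (simp add: preorder_rel_def)
qed

lemma equivalence_rel_inv_image:
  assumes X: "X \<in> Ob C" and Y: "Y \<in> Ob C" and f: "f \<in> hom C X Y" and S: "equivalence_rel C Y S"
  shows "equivalence_rel C X (rel_inv_image C f S)"
proof -
  have Sr: "S \<in> reflexive_rels C Y" "preorder_rel C Y S" "symmetric_rel C Y S"
    using S by (auto simp: equivalence_rel_def preorder_rel_def)
  note S' = reflexive_relsD[OF Y Sr(1)] and I = rel_inv_image_mono_class[OF X Y f]
  have "symmetric_rel C X (rel_inv_image C f S)"
    using Sr(3)
    unfolding symmetric_rel_iff[OF Y S'(2)] symmetric_rel_iff[OF X I(1)[OF S'(2)]] I(2)[OF S'(2)]
    by (auto simp: hom_def)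
  then show ?thesis
    using preorder_rel_inv_image[OF X Y f Sr(2)] by (simp add: equivalence_rel_def)
qed

end

section \<open>Generated preorders and equivalence relations\<close>

locale chain_complete_regular_category = regular_category +
  assumes chain_sups: "has_chain_sups C"
    and sups_stable: "chain_sups_comp_stable C"
begin

text \<open>The supremum is unique as a set of arrows, not merely up to isomorphism, because a relation
  is determined by its elements.\<close>

lemma refl_sup_is_sup:
  assumes X: "X \<in> Ob C" and R: "refl_chain C X R"
  shows "is_refl_sup C X R (refl_sup C X R)"
proof -
  obtain S where S: "is_refl_sup C X R S"
    using chain_sups X R by (auto simp: has_chain_sups_def)
  have "T = S" if T: "is_refl_sup C X R T" for T
  proof -
    have r: "S \<in> reflexive_rels C X" "T \<in> reflexive_rels C X" "sub_le C S T" "sub_le C T S"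
      using S T by (auto simp: is_refl_sup_def)
    then show ?thesis
      using relations_eqI[OF X] reflexive_relsD(1)[OF X] reflexive_le_iff[OF X] by metis
  qed
  then show ?thesis unfolding refl_sup_def using S theI[of "is_refl_sup C X R" S] by blast
qed

lemma refl_sup_props:
  assumes "X \<in> Ob C" "refl_chain C X R"
  shows "refl_sup C X R \<in> reflexive_rels C X" "sub_le C (R i) (refl_sup C X R)"
    "T \<in> reflexive_rels C X \<Longrightarrow> (\<And>i. sub_le C (R i) T) \<Longrightarrow> sub_le C (refl_sup C X R) T"
  using refl_sup_is_sup[OF assms] by (auto simp: is_refl_sup_def)

text \<open>Stability, in the form used later: an upper bound of all \<open>R\<^sub>i T\<close> also bounds the composite of
  the supremum with \<open>T\<close>.\<close>

lemma refl_sup_comp_le: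
  assumes X: "X \<in> Ob C" and R: "refl_chain C X R"
    and T: "T \<in> reflexive_rels C X" and U: "U \<in> reflexive_rels C X"
    and le: "\<And>i. sub_le C (rel_comp C X (R i) T) U"
  shows "sub_le C (rel_comp C X (refl_sup C X R) T) U"
proof -
  have Ri: "R i \<in> reflexive_rels C X" for i using R by (simp add: refl_chain_def)
  note D = reflexive_relsD[OF X]
  have "sub_le C (rel_comp C X (R i) T) (rel_comp C X (R j) T)" if "i \<le> j" for i j
  proof -
    have "sub_le C (R i) (R j)" using R that by (simp add: refl_chain_def)
    then show ?thesis
      unfolding rel_comp_le_iff[OF X D(2)[OF T] D(2)[OF Ri] D(2)[OF rel_comp_reflexive(1)[OF X T Ri]]]
        reflexive_le_iff[OF X Ri Ri]
      using rel_comp_reflexive(2)[OF X T Ri] by blast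
  qed
  then have "refl_chain C X (\<lambda>i. rel_comp C X (R i) T)"
    unfolding refl_chain_def using rel_comp_reflexive(1)[OF X T Ri] by blast
  then have "sub_le C (refl_sup C X (\<lambda>i. rel_comp C X (R i) T)) U"
    by (rule refl_sup_props(3)[OF X _ U le])
  moreover have "refl_sup C X (\<lambda>i. rel_comp C X (R i) T) = rel_comp C X (refl_sup C X R) T"
    using sups_stable X R T by (simp add: chain_sups_comp_stable_def)
  ultimately show ?thesis by simp
qed

text \<open>The mirror image of the assumed stability. Opposites reverse composites, so a bound \<open>U\<close> of all
  \<open>T R\<^sub>i\<close> gives a bound of all \<open>R\<^sub>i\<^sup>o\<^sup>p T\<^sup>o\<^sup>p\<close>. The stable side applies to the latter, and the
  supremum of the \<open>R\<^sub>i\<close> is below the opposite of the supremum of the \<open>R\<^sub>i\<^sup>o\<^sup>p\<close>.\<close>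

lemma comp_refl_sup_le:
  assumes X: "X \<in> Ob C" and R: "refl_chain C X R"
    and T: "T \<in> reflexive_rels C X" and U: "U \<in> reflexive_rels C X"
    and le: "\<And>i. sub_le C (rel_comp C X T (R i)) U"
  shows "sub_le C (rel_comp C X T (refl_sup C X R)) U"
proof -
  let ?op = "rel_op C X"
  let ?S = "refl_sup C X R" and ?S' = "refl_sup C X (\<lambda>i. ?op (R i))"
  have Ri: "R i \<in> reflexive_rels C X" for i using R by (simp add: refl_chain_def)
  note D = reflexive_relsD[OF X] and op = rel_op_reflexive[OF X] and le_iff = reflexive_le_iff[OF X]
  have "refl_chain C X (\<lambda>i. ?op (R i))"
    unfolding refl_chain_def le_iff[OF op(1)[OF Ri] op(1)[OF Ri]] op(2)[OF Ri]
    using op(1)[OF Ri] R unfolding refl_chain_def le_iff[OF Ri Ri] by blast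
  note S' = refl_sup_props[OF X this] and S = refl_sup_props[OF X R]
  have "sub_le C (R i) (?op ?S')" for i
    using S'(2)[of i]
    unfolding le_iff[OF Ri op(1)[OF S'(1)]] le_iff[OF op(1)[OF Ri] S'(1)] op(2)[OF S'(1)] op(2)[OF Ri]
    by blast
  then have "sub_le C ?S (?op ?S')" by (rule S(3)[OF op(1)[OF S'(1)]])
  then have SS': "rel_mem C X ?S' v u" if "rel_mem C X ?S u v" for u v
    using that unfolding le_iff[OF S(1) op(1)[OF S'(1)]] op(2)[OF S'(1)] by blast
  have "sub_le C (rel_comp C X (?op (R i)) (?op T)) (?op U)" for i
    using le[of i]
    unfolding rel_comp_le_iff[OF X D(2)[OF op(1)[OF T]] D(2)[OF op(1)[OF Ri]] D(2)[OF op(1)[OF U]]]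
      rel_comp_le_iff[OF X D(2)[OF Ri] D(2)[OF T] D(2)[OF U]] op(2)[OF T] op(2)[OF U] op(2)[OF Ri]
    by blast
  then have "sub_le C (rel_comp C X ?S' (?op T)) (?op U)"
    by (rule refl_sup_comp_le[OF X \<open>refl_chain C X (\<lambda>i. ?op (R i))\<close> op(1)[OF T] op(1)[OF U]])
  then show ?thesis
    unfolding rel_comp_le_iff[OF X D(2)[OF op(1)[OF T]] D(2)[OF S'(1)] D(2)[OF op(1)[OF U]]]
      rel_comp_le_iff[OF X D(2)[OF S(1)] D(2)[OF T] D(2)[OF U]] op(2)[OF T] op(2)[OF U]
    using SS' by blast
qed

primrec iter_square :: "'a \<Rightarrow> 'b set \<Rightarrow> nat \<Rightarrow> 'b set" where
  "iter_square X R 0 = R"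
| "iter_square X R (Suc n) = rel_comp C X (iter_square X R n) (iter_square X R n)"

definition preorder_closure :: "'a \<Rightarrow> 'b set \<Rightarrow> 'b set" where
  "preorder_closure X R = refl_sup C X (iter_square X R)"

lemma iter_square_chain:
  assumes X: "X \<in> Ob C" and R: "R \<in> reflexive_rels C X"
  shows "refl_chain C X (iter_square X R)"
proof -
  have r: "iter_square X R n \<in> reflexive_rels C X" for n
    by (induction n) (simp_all add: R rel_comp_reflexive(1)[OF X])
  have "sub_le C (iter_square X R i) (iter_square X R j)" if "i \<le> j" for i j
    using that
  proof (induction j rule: dec_induct)
    case base
    show ?case using reflexive_le_iff[OF X r r] by blast
  next
    case (step n)
    then show ?case
      using reflexive_le_rel_comp(1)[OF X r r, of n n] r[of "Suc n"] unfolding reflexive_le_iff[OF X r r]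
      by (simp add: reflexive_le_iff[OF X r])
  qed
  then show ?thesis using r by (simp add: refl_chain_def)
qed

text \<open>The supremum \<open>S\<close> absorbs composites of chain members, then by the mirrored stability composites
  of a member with \<open>S\<close>, and then by the assumed stability the composite of \<open>S\<close> with itself.\<close>

lemma preorder_closure_preorder:
  assumes X: "X \<in> Ob C" and R: "R \<in> reflexive_rels C X"
  shows "preorder_rel C X (preorder_closure X R)" "sub_le C R (preorder_closure X R)"
proof -
  let ?R = "iter_square X R" and ?S = "preorder_closure X R"
  note ch = iter_square_chain[OF X R]
  note S = refl_sup_props[OF X ch, folded preorder_closure_def]
  have Ri: "?R i \<in> reflexive_rels C X" for i using ch by (simp add: refl_chain_def)
  note D = reflexive_relsD[OF X]
  have "sub_le C (rel_comp C X (?R i) (?R j)) ?S" for i j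
    unfolding rel_comp_le_iff[OF X D(2)[OF Ri] D(2)[OF Ri] D(2)[OF S(1)]]
  proof (intro allI impI)
    fix u w v assume uw: "rel_mem C X (?R j) u w" and wv: "rel_mem C X (?R i) w v"
    \<comment> \<open>Both factors are moved to the later of the two stages, where squaring absorbs them.\<close>
    let ?k = "max i j"
    have "sub_le C (?R i) (?R ?k)" "sub_le C (?R j) (?R ?k)"
      using ch by (simp_all add: refl_chain_def)
    then have "rel_mem C X (?R ?k) u w" "rel_mem C X (?R ?k) w v"
      using uw wv unfolding reflexive_le_iff[OF X Ri Ri] by blast+
    then have "rel_mem C X (?R (Suc ?k)) u v"
      using rel_comp_reflexive(2)[OF X Ri Ri] by simp
    then show "rel_mem C X ?S u v"
      using S(2)[of "Suc ?k"] unfolding reflexive_le_iff[OF X Ri S(1)] by blast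
  qed
  then have "sub_le C (rel_comp C X (?R i) ?S) ?S" for i
    unfolding preorder_closure_def
    by (intro comp_refl_sup_le[OF X ch Ri]) (simp_all add: S(1) flip: preorder_closure_def)
  then have "sub_le C (rel_comp C X ?S ?S) ?S"
    using refl_sup_comp_le[OF X ch S(1) S(1)] by (simp add: preorder_closure_def)
  then show "preorder_rel C X ?S" using S(1) by (simp add: preorder_rel_def transitive_rel_def)
  show "sub_le C R ?S" using S(2)[of 0] by simp
qed

lemma preorder_closure_least:
  assumes X: "X \<in> Ob C" and R: "R \<in> reflexive_rels C X" and T: "preorder_rel C X T"
    and RT: "sub_le C R T"
  shows "sub_le C (preorder_closure X R) T"
proof -
  note ch = iter_square_chain[OF X R]
  have Ri: "iter_square X R i \<in> reflexive_rels C X" for i using ch by (simp add: refl_chain_def)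
  have Tr: "T \<in> reflexive_rels C X" "transitive_rel C X T" using T by (auto simp: preorder_rel_def)
  note D = reflexive_relsD[OF X]
  have "sub_le C (iter_square X R n) T" for n
  proof (induction n)
    case (Suc n)
    then show ?case
      using Tr(2)
      unfolding iter_square.simps rel_comp_le_iff[OF X D(2)[OF Ri] D(2)[OF Ri] D(2)[OF Tr(1)]]
        reflexive_le_iff[OF X Ri Tr(1)] transitive_rel_iff[OF X D(2)[OF Tr(1)]]
      by blast
  qed (simp add: RT)
  then show ?thesis
    unfolding preorder_closure_def by (rule refl_sup_props(3)[OF X ch Tr(1)])
qed

text \<open>The opposite of the closure is a preorder, and it contains \<open>R\<close> by symmetry of \<open>R\<close>; hence it
  contains the closure.\<close>

lemma preorder_closure_symmetric:
  assumes X: "X \<in> Ob C" and R: "R \<in> reflexive_rels C X" and sym: "symmetric_rel C X R"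
  shows "equivalence_rel C X (preorder_closure X R)"
proof -
  let ?S = "preorder_closure X R"
  note S = preorder_closure_preorder[OF X R]
  have Sr: "?S \<in> reflexive_rels C X" "transitive_rel C X ?S" using S by (auto simp: preorder_rel_def)
  note D = reflexive_relsD[OF X] and op = rel_op_reflexive[OF X Sr(1)]
  have "transitive_rel C X (rel_op C X ?S)"
    using Sr(2)
    unfolding transitive_rel_iff[OF X D(2)[OF op(1)]] transitive_rel_iff[OF X D(2)[OF Sr(1)]] op(2)
    by blast
  then have "preorder_rel C X (rel_op C X ?S)" using op(1) by (simp add: preorder_rel_def)
  moreover have "sub_le C R (rel_op C X ?S)"
    using S(2) sym
    unfolding reflexive_le_iff[OF X R op(1)] reflexive_le_iff[OF X R Sr(1)] op(2)
      symmetric_rel_iff[OF X D(2)[OF R]]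
    by blast
  ultimately have "sub_le C ?S (rel_op C X ?S)" by (rule preorder_closure_least[OF X R])
  then have "symmetric_rel C X ?S"
    unfolding reflexive_le_iff[OF X Sr(1) op(1)] op(2) symmetric_rel_iff[OF X D(2)[OF Sr(1)]] .
  then show ?thesis using S(1) by (simp add: equivalence_rel_def)
qed

text \<open>Composing with the opposite symmetrizes \<open>R\<close>; for reflexive \<open>R\<close> the composite lies above both
  factors, so it plays the role of a symmetric upper bound where no union of relations is at
  hand.\<close>

definition equivalence_closure :: "'a \<Rightarrow> 'b set \<Rightarrow> 'b set" where
  "equivalence_closure X R = preorder_closure X (rel_comp C X R (rel_op C X R))"

lemma equivalence_closure_equivalence:
  assumes X: "X \<in> Ob C" and R: "R \<in> reflexive_rels C X"
  shows "equivalence_rel C X (equivalence_closure X R)" "sub_le C R (equivalence_closure X R)"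
proof -
  let ?Q = "rel_comp C X R (rel_op C X R)"
  note op = rel_op_reflexive[OF X R]
  note Q = rel_comp_reflexive[OF X op(1) R]
  note D = reflexive_relsD[OF X]
  have "sub_le C ?Q (rel_op C X ?Q)"
    unfolding rel_comp_le_iff[OF X D(2)[OF op(1)] D(2)[OF R] D(2)[OF rel_op_reflexive(1)[OF X Q(1)]]]
      rel_op_reflexive(2)[OF X Q(1)]
    using Q(2) op(2) by blast
  then have "symmetric_rel C X ?Q"
    unfolding symmetric_rel_iff[OF X D(2)[OF Q(1)]]
      reflexive_le_iff[OF X Q(1) rel_op_reflexive(1)[OF X Q(1)]] rel_op_reflexive(2)[OF X Q(1)] .
  then show E: "equivalence_rel C X (equivalence_closure X R)"
    unfolding equivalence_closure_def by (rule preorder_closure_symmetric[OF X Q(1)])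
  have "equivalence_closure X R \<in> reflexive_rels C X"
    using E by (simp add: equivalence_rel_def preorder_rel_def)
  then show "sub_le C R (equivalence_closure X R)"
    using reflexive_le_rel_comp(2)[OF X op(1) R] preorder_closure_preorder(2)[OF X Q(1)]
    unfolding equivalence_closure_def[symmetric]
    by (simp add: reflexive_le_iff[OF X] R Q(1))
qed

lemma equivalence_closure_least:
  assumes X: "X \<in> Ob C" and R: "R \<in> reflexive_rels C X" and T: "equivalence_rel C X T"
    and RT: "sub_le C R T"
  shows "sub_le C (equivalence_closure X R) T"
proof -
  note op = rel_op_reflexive[OF X R]
  note Q = rel_comp_reflexive[OF X op(1) R]
  note D = reflexive_relsD[OF X]
  have T': "preorder_rel C X T" "T \<in> reflexive_rels C X" "transitive_rel C X T" "symmetric_rel C X T"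
    using T by (auto simp: equivalence_rel_def preorder_rel_def)
  have "sub_le C (rel_comp C X R (rel_op C X R)) T"
    using RT T'(3,4)
    unfolding rel_comp_le_iff[OF X D(2)[OF op(1)] D(2)[OF R] D(2)[OF T'(2)]] op(2)
      reflexive_le_iff[OF X R T'(2)] transitive_rel_iff[OF X D(2)[OF T'(2)]]
      symmetric_rel_iff[OF X D(2)[OF T'(2)]]
    by blast
  then show ?thesis
    unfolding equivalence_closure_def by (rule preorder_closure_least[OF X Q(1) T'(1)])
qed

end

section \<open>Closure operations as reflections\<close>

context regular_category
begin

lemma RefCat_simps:
  "Ob (RefCat C) = {(X, R). X \<in> Ob C \<and> R \<in> reflexive_rels C X}"
  "Dom (RefCat C) (a, f, b) = a" "Cod (RefCat C) (a, f, b) = b"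
  "Idn (RefCat C) a = (a, Idn C (fst a), a)"
  "(b', g, c) \<cdot>\<^bsub>RefCat C\<^esub> (a, f, b) = (a, g \<cdot> f, c)"
  by (simp_all add: RefCat_def)

lemma RefCat_Ar_iff:
  "((X, R), f, (Y, S)) \<in> Ar (RefCat C) \<longleftrightarrow> X \<in> Ob C \<and> R \<in> reflexive_rels C X \<and>
     Y \<in> Ob C \<and> S \<in> reflexive_rels C Y \<and> f \<in> hom C X Y \<and>
     (\<forall>u v. rel_mem C X R u v \<longrightarrow> rel_mem C Y S (f \<cdot> u) (f \<cdot> v))"
  using le_inv_image_iff[of X Y f R S] reflexive_relsD(2)[of X R] reflexive_relsD(2)[of Y S]
  by (auto simp: RefCat_def)

lemma RefCat_comp:
  assumes "(a, f, b) \<in> Ar (RefCat C)" "(b, g, c) \<in> Ar (RefCat C)"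
  shows "(a, g \<cdot> f, c) \<in> Ar (RefCat C)"
proof -
  obtain X R Y S Z T where abc: "a = (X, R)" "b = (Y, S)" "c = (Z, T)" by (metis prod.exhaust)
  note f = assms(1)[unfolded abc RefCat_Ar_iff] and g = assms(2)[unfolded abc RefCat_Ar_iff]
  have "rel_mem C Z T ((g \<cdot> f) \<cdot> u) ((g \<cdot> f) \<cdot> v)" if uv: "rel_mem C X R u v" for u v
  proof -
    have "u \<in> hom C (Dom C u) X" "v \<in> hom C (Dom C u) X"
      using rel_mem_hom[OF _ _ uv] reflexive_relsD(2) f by blast+
    then have "(g \<cdot> f) \<cdot> u = g \<cdot> (f \<cdot> u)" "(g \<cdot> f) \<cdot> v = g \<cdot> (f \<cdot> v)"
      using f g comp_assoc by blast+
    then show ?thesis using f g uv by simp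
  qed
  moreover have "g \<cdot> f \<in> hom C X Z" using f g comp_hom by blast
  ultimately show ?thesis unfolding abc RefCat_Ar_iff using f g by blast
qed

lemma RefCat_idn:
  assumes "(X, R) \<in> Ob (RefCat C)"
  shows "((X, R), Idn C X, (X, R)) \<in> Ar (RefCat C)"
proof -
  have X: "X \<in> Ob C" and R: "R \<in> reflexive_rels C X" using assms by (auto simp: RefCat_simps)
  have "rel_mem C X R (Idn C X \<cdot> u) (Idn C X \<cdot> v)" if uv: "rel_mem C X R u v" for u v
    using rel_mem_hom[OF X reflexive_relsD(2)[OF X R] uv] uv comp_idn_left by metis
  then show ?thesis unfolding RefCat_Ar_iff using X R idn_hom by blast
qed

lemma RefCat_arD:
  assumes "(a, f, b) \<in> Ar (RefCat C)"
  shows "f \<in> hom C (fst a) (fst b)" "a \<in> Ob (RefCat C)" "b \<in> Ob (RefCat C)"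
  using assms by (auto simp: RefCat_def)

lemma RefCat_category: "category (RefCat C)"
proof
  fix f a b assume f: "f \<in> hom (RefCat C) a b"
  then obtain f' where f': "f = (a, f', b)" "(a, f', b) \<in> Ar (RefCat C)"
    by (cases f) (auto simp: hom_def RefCat_simps)
  note D = RefCat_arD[OF f'(2)]
  show "f \<cdot>\<^bsub>RefCat C\<^esub> Idn (RefCat C) a = f" "Idn (RefCat C) b \<cdot>\<^bsub>RefCat C\<^esub> f = f"
    using comp_idn_right[OF D(1)] comp_idn_left[OF D(1)] by (simp_all add: f' RefCat_simps)
  fix g c assume g: "g \<in> hom (RefCat C) b c"
  then obtain g' where g': "g = (b, g', c)" "(b, g', c) \<in> Ar (RefCat C)"
    by (cases g) (auto simp: hom_def RefCat_simps)
  show "g \<cdot>\<^bsub>RefCat C\<^esub> f \<in> hom (RefCat C) a c"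
    using RefCat_comp[OF f'(2) g'(2)] by (simp add: f' g' hom_def RefCat_simps)
  fix h d assume h: "h \<in> hom (RefCat C) c d"
  then obtain h' where h': "h = (c, h', d)" "(c, h', d) \<in> Ar (RefCat C)"
    by (cases h) (auto simp: hom_def RefCat_simps)
  show "(h \<cdot>\<^bsub>RefCat C\<^esub> g) \<cdot>\<^bsub>RefCat C\<^esub> f = h \<cdot>\<^bsub>RefCat C\<^esub> (g \<cdot>\<^bsub>RefCat C\<^esub> f)"
    using comp_assoc[OF D(1) RefCat_arD(1)[OF g'(2)] RefCat_arD(1)[OF h'(2)]]
    by (simp add: f' g' h' RefCat_simps)
next
  fix f assume f: "f \<in> Ar (RefCat C)"
  obtain a f' b where "f = (a, f', b)" by (cases f) auto
  then show "Dom (RefCat C) f \<in> Ob (RefCat C)" "Cod (RefCat C) f \<in> Ob (RefCat C)"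
    using f RefCat_arD[of a f' b] by (simp_all add: RefCat_simps)
next
  fix a assume "a \<in> Ob (RefCat C)"
  then show "Idn (RefCat C) a \<in> hom (RefCat C) a a"
    using RefCat_idn[of "fst a" "snd a"] by (simp add: hom_def RefCat_simps)
qed

end

lemma category_full_subcat:
  assumes "category C" shows "category (full_subcat C P)"
proof -
  interpret category C by fact
  have hom: "f \<in> hom (full_subcat C P) a b \<longleftrightarrow> f \<in> hom C a b \<and> P a \<and> P b" for f a b
    by (auto simp: hom_def full_subcat_def)
  show ?thesis
    by unfold_locales
      (auto simp: hom intro: comp_hom comp_assoc comp_idn_left comp_idn_right idn_hom,
       auto simp: full_subcat_def dom_ob cod_ob idn_hom comp_idn_left comp_idn_right comp_assoc
         intro: comp_hom)
qed

context regular_category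
begin

text \<open>The inverse image \<open>f\<^sup>-\<^sup>1(S)\<close> of a relation with property \<open>P\<close> is one of the candidates above \<open>R\<close>
  that the closure minimizes over. So the same arrows \<open>f\<close> underlie morphisms from \<open>R\<close> and from its
  closure, and the adjunction bijection merely relabels the source. The property \<open>P\<close> is a
  predicate on pairs because it selects objects of the category of reflexive relations.\<close>

lemma closure_left_adjoint:
  fixes cl :: "'a \<Rightarrow> 'b set \<Rightarrow> 'b set"
  assumes cl: "\<And>X R. X \<in> Ob C \<Longrightarrow> R \<in> reflexive_rels C X \<Longrightarrow>
      cl X R \<in> reflexive_rels C X \<and> P (X, cl X R) \<and> sub_le C R (cl X R)"
    and least: "\<And>X R T. X \<in> Ob C \<Longrightarrow> R \<in> reflexive_rels C X \<Longrightarrow> T \<in> reflexive_rels C X \<Longrightarrow>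
      P (X, T) \<Longrightarrow> sub_le C R T \<Longrightarrow> sub_le C (cl X R) T"
    and inv: "\<And>X Y f S. X \<in> Ob C \<Longrightarrow> Y \<in> Ob C \<Longrightarrow> f \<in> hom C X Y \<Longrightarrow>
      S \<in> reflexive_rels C Y \<Longrightarrow> P (Y, S) \<Longrightarrow> P (X, rel_inv_image C f S)"
  shows "has_left_adjoint (full_subcat (RefCat C) P) (RefCat C) (\<lambda>a. a) (\<lambda>f. f)"
proof -
  let ?D = "RefCat C" and ?A = "full_subcat (RefCat C) P"
  define Lo where "Lo = (\<lambda>(X, R). (X, cl X R))"
  define La where "La = (\<lambda>(a, f :: 'b, b). (Lo a, f, Lo b))"
  define \<phi> where "\<phi> = (\<lambda>(x :: 'a \<times> 'b set) (y :: 'a \<times> 'b set) (a :: 'a \<times> 'b set, f :: 'b, b :: 'a \<times> 'b set).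
    (x, f, b))"
  have A: "Ob ?A = {a \<in> Ob ?D. P a}" "Dom ?A = Dom ?D" "Cod ?A = Cod ?D" "Idn ?A = Idn ?D"
    "Comp ?A = Comp ?D" "Ar ?A = {f \<in> Ar ?D. P (Dom ?D f) \<and> P (Cod ?D f)}"
    by (simp_all add: full_subcat_def)
  have Lo: "Lo x \<in> Ob ?D" "P (Lo x)" "(x, Idn C (fst x), Lo x) \<in> Ar ?D" "fst (Lo x) = fst x"
    if x: "x \<in> Ob ?D" for x
  proof -
    obtain X R where XR: "x = (X, R)" by (cases x)
    have X: "X \<in> Ob C" and R: "R \<in> reflexive_rels C X" using x by (auto simp: XR RefCat_simps)
    note c = cl[OF X R]
    show "Lo x \<in> Ob ?D" "P (Lo x)" "fst (Lo x) = fst x"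
      using c X by (auto simp: XR Lo_def RefCat_simps)
    have "rel_mem C X (cl X R) (Idn C X \<cdot> u) (Idn C X \<cdot> v)" if uv: "rel_mem C X R u v" for u v
      using rel_mem_hom[OF X reflexive_relsD(2)[OF X R] uv] uv comp_idn_left c
        reflexive_le_iff[OF X R] by metis
    then show "(x, Idn C (fst x), Lo x) \<in> Ar ?D"
      using c X R idn_hom[OF X] by (simp add: XR Lo_def RefCat_Ar_iff)
  qed
  \<comment> \<open>Restricting along the unit and extending along it keep the underlying arrow; only the
    extension depends on the minimality of the closure.\<close>
  have unit: "(x, f, b) \<in> Ar ?D" if f: "(Lo x, f, b) \<in> Ar ?D" and x: "x \<in> Ob ?D" for x f b
    using RefCat_comp[OF Lo(3)[OF x] f] comp_idn_right[OF RefCat_arD(1)[OF f]] Lo(4)[OF x] by simp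
  have extend: "(Lo x, f, b) \<in> Ar ?D" if f: "(x, f, b) \<in> Ar ?D" and b: "P b" for x f b
  proof -
    obtain X R Y S where xb: "x = (X, R)" "b = (Y, S)" by (metis prod.exhaust)
    note F = f[unfolded xb RefCat_Ar_iff]
    then have X: "X \<in> Ob C" and R: "R \<in> reflexive_rels C X" and Y: "Y \<in> Ob C"
      and S: "S \<in> reflexive_rels C Y" and fh: "f \<in> hom C X Y" by auto
    note mc = reflexive_relsD(2)[OF X] and S' = reflexive_relsD(2)[OF Y S]
    note c = cl[OF X R]
    have "sub_le C R (rel_inv_image C f S)"
      unfolding le_inv_image_iff[OF X Y fh mc[OF R] S'] using F by blast
    then have "sub_le C (cl X R) (rel_inv_image C f S)"
      using least[OF X R rel_inv_image_reflexive[OF X Y fh S] inv[OF X Y fh S]] b xb by simp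
    then show ?thesis
      using c X Y S fh le_inv_image_iff[OF X Y fh mc S'] by (simp add: xb Lo_def RefCat_Ar_iff)
  qed
  have La: "La f \<in> Ar ?A" "Dom ?D (La f) = Lo (Dom ?D f)" "Cod ?D (La f) = Lo (Cod ?D f)"
    if f: "f \<in> Ar ?D" for f
  proof -
    obtain a g b where g: "f = (a, g, b)" by (cases f) auto
    note D = RefCat_arD[OF f[unfolded g]]
    have "(a, Idn C (fst b) \<cdot> g, Lo b) \<in> Ar ?D"
      by (rule RefCat_comp[OF f[unfolded g] Lo(3)[OF D(3)]])
    then have "(a, g, Lo b) \<in> Ar ?D" using comp_idn_left[OF D(1)] by simp
    then have "(Lo a, g, Lo b) \<in> Ar ?D" by (rule extend[OF _ Lo(2)[OF D(3)]])
    then show "La f \<in> Ar ?A" "Dom ?D (La f) = Lo (Dom ?D f)" "Cod ?D (La f) = Lo (Cod ?D f)"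
      using Lo(2) D by (simp_all add: g La_def A RefCat_simps)
  qed
  have catD: "category ?D" by (rule RefCat_category)
  then have catA: "category ?A" by (rule category_full_subcat)
  have La_Idn: "La (Idn ?D a) = Idn ?D (Lo a)" if "a \<in> Ob ?D" for a
    using Lo(4)[OF that] by (simp add: La_def RefCat_simps)
  have La_comp: "La (g \<cdot>\<^bsub>?D\<^esub> f) = La g \<cdot>\<^bsub>?D\<^esub> La f" for f g
    by (cases f; cases g) (simp add: La_def RefCat_simps)
  have "is_functor ?D ?A Lo La"
    unfolding is_functor_def using catD catA Lo La La_Idn La_comp by (auto simp: A hom_def)
  moreover have "is_functor ?A ?D (\<lambda>a. a) (\<lambda>f. f)"
    unfolding is_functor_def using catD catA by (auto simp: A hom_def)
  moreover have "bij_betw (\<phi> x y) (hom ?A (Lo x) y) (hom ?D x y)"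
    if x: "x \<in> Ob ?D" and y: "y \<in> Ob ?A" for x y
  proof -
    have homD: "k \<in> hom ?D a b \<longleftrightarrow> (\<exists>f. k = (a, f, b) \<and> (a, f, b) \<in> Ar ?D)" for k a b
      by (cases k) (auto simp: hom_def RefCat_simps)
    have "k \<in> hom ?A (Lo x) y \<longleftrightarrow> k \<in> hom ?D (Lo x) y" for k
      using Lo(2)[OF x] y by (auto simp: hom_def A)
    then have homA: "k \<in> hom ?A (Lo x) y \<longleftrightarrow> (\<exists>f. k = (Lo x, f, y) \<and> (Lo x, f, y) \<in> Ar ?D)" for k
      using homD by simp
    have Py: "P y" using y by (simp add: A)
    have ar: "(Lo x, f, y) \<in> Ar ?D \<longleftrightarrow> (x, f, y) \<in> Ar ?D" for f
      using unit[OF _ x] extend[OF _ Py] by blast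
    show ?thesis
    proof (rule bij_betw_byWitness[where f' = "\<lambda>(a, f, b). (Lo x, f, b)"])
      show "\<forall>k\<in>hom ?A (Lo x) y. (\<lambda>(a, f, b). (Lo x, f, b)) (\<phi> x y k) = k"
        by (auto simp: homA \<phi>_def)
      show "\<forall>k\<in>hom ?D x y. \<phi> x y ((\<lambda>(a, f, b). (Lo x, f, b)) k) = k"
        by (auto simp: homD \<phi>_def)
      show "\<phi> x y ` hom ?A (Lo x) y \<subseteq> hom ?D x y"
      proof (intro image_subsetI)
        fix k assume "k \<in> hom ?A (Lo x) y"
        then obtain f where "k = (Lo x, f, y)" "(Lo x, f, y) \<in> Ar ?D" unfolding homA by blast
        then show "\<phi> x y k \<in> hom ?D x y" unfolding homD by (simp add: \<phi>_def ar)
      qed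
      show "(\<lambda>(a, f, b). (Lo x, f, b)) ` hom ?D x y \<subseteq> hom ?A (Lo x) y"
      proof (intro image_subsetI)
        fix k assume "k \<in> hom ?D x y"
        then obtain f where "k = (x, f, y)" "(x, f, y) \<in> Ar ?D" unfolding homD by blast
        then show "(\<lambda>(a, f, b). (Lo x, f, b)) k \<in> hom ?A (Lo x) y"
          unfolding homA by (simp add: ar)
      qed
    qed
  qed
  moreover have "\<phi> (Dom ?D h) (Cod ?A k) (k \<cdot>\<^bsub>?A\<^esub> g \<cdot>\<^bsub>?A\<^esub> La h)
      = k \<cdot>\<^bsub>?D\<^esub> \<phi> (Cod ?D h) (Dom ?A k) g \<cdot>\<^bsub>?D\<^esub> h" for h k g
    by (cases h; cases k; cases g) (simp add: A La_def \<phi>_def RefCat_simps)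
  ultimately have "adjunction ?A ?D Lo La (\<lambda>a. a) (\<lambda>f. f) \<phi>"
    unfolding adjunction_def by blast
  then show ?thesis unfolding has_left_adjoint_def by blast
qed

end

theorem corollary3p2:
  fixes E :: "('o, 'm) cat"
  assumes "regular_category E"
    and "has_chain_sups E"
    and "chain_sups_comp_stable E"
  shows "has_left_adjoint (PrOCat E) (RefCat E) (\<lambda>a. a) (\<lambda>f. f)
       \<and> has_left_adjoint (EquCat E) (RefCat E) (\<lambda>a. a) (\<lambda>f. f)"
proof -
  interpret chain_complete_regular_category E
    using assms by (simp add: chain_complete_regular_category_def
      chain_complete_regular_category_axioms_def)
  have "has_left_adjoint (PrOCat E) (RefCat E) (\<lambda>a. a) (\<lambda>f. f)"
    unfolding PrOCat_def
  proof (rule closure_left_adjoint[where cl = preorder_closure])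
  qed (use preorder_closure_preorder preorder_closure_least preorder_rel_inv_image in
      \<open>auto simp: preorder_rel_def\<close>)
  moreover have "has_left_adjoint (EquCat E) (RefCat E) (\<lambda>a. a) (\<lambda>f. f)"
    unfolding EquCat_def
  proof (rule closure_left_adjoint[where cl = equivalence_closure])
  qed (use equivalence_closure_equivalence equivalence_closure_least equivalence_rel_inv_image in
      \<open>auto simp: equivalence_rel_def preorder_rel_def\<close>)
  ultimately show ?thesis ..
qed

end
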